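(* For every $k\in\mathbb Z$, $\Lambda_k$ is a smooth bounded function on $\mathbb R$ with $\Lambda_k(t)\to1$ as $t\to-\infty$ and $\Lambda_k(t)\to0$ as $t\to+\infty$, and the function $v_k(x,z):=r^{\frac12+3k}\Lambda_k(t)$, with $r=(z^2+x^{2/3})^{1/2}$ and $t=zx^{-1/3}$, satisfies $z\partial_xv_k-\partial_{zz}v_k=0$ in $(0,\infty)\times\mathbb R$ and $v_k(0,z)=0$ for $z>0$ (as a limit $x\to0^+$).
   Context: Let $M(a,b,\zeta)=\sum_{n\ge0}\frac{(a)_n}{(b)_n}\frac{\zeta^n}{n!}$ be Kummer's confluent hypergeometric function ($(a)_n$ the rising factorial). For $k\in\mathbb Z$ define $$\Lambda_k(t)=9^{\frac16+k}(1+t^2)^{-\frac14-\frac{3k}2}\Big[\tfrac{\Gamma(1/3)}{\Gamma(1/6-k)}M\big(-\tfrac16-k,\tfrac23,-\tfrac{t^3}{9}\big)-\tfrac{t}{9^{1/3}}\tfrac{\Gamma(-1/3)}{\Gamma(-1/6-k)}M\big(\tfrac16-k,\tfrac43,-\tfrac{t^3}{9}\big)\Big].$$ *)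

theory Defs
  imports "HOL-Analysis.Analysis"
begin

definition kummerM :: "real \<Rightarrow> real \<Rightarrow> real \<Rightarrow> real" where
  "kummerM a b \<zeta> = (\<Sum>n. pochhammer a n / pochhammer b n * \<zeta> ^ n / fact n)"

definition Lambda :: "int \<Rightarrow> real \<Rightarrow> real" where
  "Lambda k t =
     9 powr (1/6 + of_int k) * (1 + t^2) powr (-1/4 - 3 * of_int k / 2) *
     (Gamma (1/3) / Gamma (1/6 - of_int k) * kummerM (-1/6 - of_int k) (2/3) (- (t^3) / 9)
      - t / 9 powr (1/3) * (Gamma (-1/3) / Gamma (-1/6 - of_int k))
          * kummerM (1/6 - of_int k) (4/3) (- (t^3) / 9))"

definition vfun :: "int \<Rightarrow> real \<Rightarrow> real \<Rightarrow> real" where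
  "vfun k x z = sqrt (z^2 + x powr (2/3)) powr (1/2 + 3 * of_int k) * Lambda k (z * x powr (-1/3))"

definition smooth_real :: "(real \<Rightarrow> real) \<Rightarrow> bool" where
  "smooth_real f \<longleftrightarrow> (\<forall>n x. ((deriv ^^ n) f) differentiable (at x))"

end

theory Submission
  imports Defs "HOL-Real_Asymp.Real_Asymp"
begin

text \<open>
  Put \<open>a = -1/6 - k\<close>. Then \<open>\<Lambda>\<^sub>k(t) = 9\<^bsup>-a\<^esup> (1 + t\<^sup>2)\<^bsup>3a/2\<^esup> W(t)\<close> and \<open>v\<^sub>k(x,z) = 9\<^bsup>-a\<^esup> x\<^bsup>-a\<^esup> W(z x\<^bsup>-1/3\<^esup>)\<close>, where
  \<open>W\<close> is Tricomi's function \<open>U(a, 2/3, -t\<^sup>3/9)\<close>, continued through \<open>t = 0\<close>. Kummer's equation becomes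
  \<open>W'' + (t\<^sup>2/3) W' + a t W = 0\<close>, which is the differential equation for \<open>v\<^sub>k\<close> and, being polynomial,
  also gives smoothness.

  All limits follow from \<open>M(a,b,x) \<sim> \<Gamma>(b)/\<Gamma>(a) e\<^sup>x x\<^bsup>a-b\<^esup>\<close> as \<open>x \<rightarrow> \<infinity>\<close>. The coefficients
  of \<open>M\<close> are asymptotic to those of \<open>\<Sum> (n+1)\<^sup>c x\<^sup>n/n!\<close> with \<open>c = a - b\<close>, up to the factor \<open>\<Gamma>(b)/\<Gamma>(a)\<close>.
  That series is treated for integer \<open>c\<close> by shifting the summation index, and then for real \<open>c\<close> by
  squeezing \<open>y\<^sup>c\<close> between combinations of integer powers of \<open>y\<close> that agree with it at \<open>y = 1\<close>.

  As \<open>t \<rightarrow> +\<infinity>\<close>, Kummer's transformation yields the leading terms of the two solutions making up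
  \<open>W\<close>, and they cancel by the reflection formula. As \<open>t \<rightarrow> -\<infinity>\<close> the exponentially growing terms cancel,
  so \<open>W\<close> divided by the first solution \<open>w\<^sub>1\<close> tends to 0; its derivative is explicit, since the
  Wronskian is \<open>exp(-t\<^sup>3/9)\<close>, and l'Hopital's rule recovers \<open>W(t) \<sim> (-t\<^sup>3/9)\<^bsup>-a\<^esup>\<close>.
\<close>

section \<open>Exponential series with power coefficients\<close>

text \<open>Abelian comparison: subtract \<open>L * g\<close> from \<open>f\<close>. Beyond some
  \<open>N\<close> the remainder is at most \<open>e * g n\<close>, so its series is controlled by
  \<open>e\<close> times that of \<open>g\<close>; the finitely many earlier terms form a
  polynomial, which the weight \<open>exp (- x)\<close> sends to 0.\<close>

lemma exp_series_abelian:
  fixes f g :: "nat \<Rightarrow> real"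
  assumes g_nonneg: "\<And>n. 0 \<le> g n"
    and g_pos: "\<forall>\<^sub>F n in sequentially. 0 < g n"
    and summable_g: "\<And>x. 0 < x \<Longrightarrow> summable (\<lambda>n. g n * x ^ n / fact n)"
    and ratio: "(\<lambda>n. f n / g n) \<longlonglongrightarrow> L"
    and lim_g: "((\<lambda>x. (\<Sum>n. g n * x ^ n / fact n) * (exp (- x) * x powr (- c))) \<longlongrightarrow> 1) at_top"
  shows "((\<lambda>x. (\<Sum>n. f n * x ^ n / fact n) * (exp (- x) * x powr (- c))) \<longlongrightarrow> L) at_top"
proof -
  let ?w = "\<lambda>x::real. exp (- x) * x powr (- c)"
  let ?F = "\<lambda>x. \<Sum>n. f n * x ^ n / fact n" and ?G = "\<lambda>x. \<Sum>n. g n * x ^ n / fact n"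
  define d where "d n = f n - L * g n" for n
  have bound: "\<exists>N. \<forall>x>0. \<bar>?F x - L * ?G x\<bar>
      \<le> (\<Sum>n<N. \<bar>d n\<bar> * x ^ n / fact n) + e * ?G x" if "e > 0" for e
  proof -
    have "\<forall>\<^sub>F n in sequentially. \<bar>f n / g n - L\<bar> < e"
      using tendstoD[OF ratio that] by (simp add: dist_real_def)
    then have "\<forall>\<^sub>F n in sequentially. \<bar>d n\<bar> \<le> e * g n"
      using g_pos
    proof eventually_elim
      case (elim n)
      have "d n = (f n / g n - L) * g n" using elim by (simp add: d_def field_simps)
      then show ?case using elim by (simp add: abs_mult)
    qed
    then obtain N where N: "\<And>n. n \<ge> N \<Longrightarrow> \<bar>d n\<bar> \<le> e * g n"
      by (auto simp: eventually_sequentially)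
    have "\<bar>?F x - L * ?G x\<bar> \<le> (\<Sum>n<N. \<bar>d n\<bar> * x ^ n / fact n) + e * ?G x" if x: "x > 0" for x
    proof -
      \<comment> \<open>The finite head is padded with zeros to a series, so that head and tail can
        be compared termwise at once.\<close>
      define p where "p n = (if n < N then \<bar>d n\<bar> * x ^ n / fact n else 0)" for n
      have p: "p sums (\<Sum>n<N. \<bar>d n\<bar> * x ^ n / fact n)"
        unfolding p_def using sums_If_finite_set[of "{..<N}" "\<lambda>n. \<bar>d n\<bar> * x ^ n / fact n"] by simp
      have eg: "(\<lambda>n. e * (g n * x ^ n / fact n)) sums (e * ?G x)"
        by (intro sums_mult summable_sums summable_g x)
      have le: "\<bar>d n * x ^ n / fact n\<bar> \<le> p n + e * (g n * x ^ n / fact n)" for n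
      proof (cases "n < N")
        case True
        then show ?thesis using x \<open>e > 0\<close> g_nonneg[of n]
          by (simp add: p_def abs_mult)
      next
        case False
        then have "\<bar>d n\<bar> * (x ^ n / fact n) \<le> (e * g n) * (x ^ n / fact n)"
          using N[of n] x by (intro mult_right_mono) auto
        then show ?thesis using x False by (simp add: p_def abs_mult)
      qed
      have s: "summable (\<lambda>n. \<bar>d n * x ^ n / fact n\<bar>)"
        by (rule summable_comparison_test'[OF sums_summable[OF sums_add[OF p eg]], of 0]) (use le in auto)
      have sd: "(\<lambda>n. d n * x ^ n / fact n) sums (\<Sum>n. d n * x ^ n / fact n)"
        by (intro summable_sums) (use s in \<open>auto intro: summable_norm_cancel\<close>)
      have "(\<lambda>n. d n * x ^ n / fact n + L * (g n * x ^ n / fact n)) sums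
          ((\<Sum>n. d n * x ^ n / fact n) + L * ?G x)"
        by (intro sums_add sd sums_mult summable_sums summable_g x)
      then have "(\<lambda>n. f n * x ^ n / fact n) sums ((\<Sum>n. d n * x ^ n / fact n) + L * ?G x)"
        by (simp add: d_def field_simps)
      then have "?F x - L * ?G x = (\<Sum>n. d n * x ^ n / fact n)"
        by (simp add: sums_iff)
      also have "\<bar>\<dots>\<bar> \<le> (\<Sum>n. \<bar>d n * x ^ n / fact n\<bar>)"
        by (rule summable_rabs[OF s])
      also have "\<dots> \<le> (\<Sum>n<N. \<bar>d n\<bar> * x ^ n / fact n) + e * ?G x"
        using sums_le[OF _ summable_sums[OF s] sums_add[OF p eg]] le by blast
      finally show ?thesis .
    qed
    then show ?thesis by blast
  qed
  have "((\<lambda>x. (?F x - L * ?G x) * ?w x) \<longlongrightarrow> 0) at_top"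
  proof (rule tendstoI)
    fix e :: real assume e: "e > 0"
    \<comment> \<open>The weighted \<open>?G\<close> is eventually below 2, so \<open>e / 4\<close>
      costs at most \<open>e / 2\<close> and leaves \<open>e / 2\<close> for the head.\<close>
    obtain N where N: "\<And>x. x > 0 \<Longrightarrow>
        \<bar>?F x - L * ?G x\<bar> \<le> (\<Sum>n<N. \<bar>d n\<bar> * x ^ n / fact n) + (e / 4) * ?G x"
      using bound[of "e / 4"] e by auto
    have "((\<lambda>x. \<Sum>n<N. \<bar>d n\<bar> / fact n * (x ^ n * ?w x)) \<longlongrightarrow> (\<Sum>n<N. \<bar>d n\<bar> / fact n * 0)) at_top"
    proof (intro tendsto_sum tendsto_mult tendsto_const)
      show "((\<lambda>x. x ^ n * ?w x) \<longlongrightarrow> 0) at_top" for n :: nat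
        by real_asymp
    qed
    then have "((\<lambda>x. \<Sum>n<N. \<bar>d n\<bar> / fact n * (x ^ n * ?w x)) \<longlongrightarrow> 0) at_top"
      by simp
    then have "\<forall>\<^sub>F x in at_top. (\<Sum>n<N. \<bar>d n\<bar> / fact n * (x ^ n * ?w x)) < e / 2"
      using e by (intro order_tendstoD(2)) auto
    moreover have "\<forall>\<^sub>F x in at_top. ?G x * ?w x < 2"
      using lim_g by (intro order_tendstoD(2)) auto
    ultimately show "\<forall>\<^sub>F x in at_top. dist ((?F x - L * ?G x) * ?w x) 0 < e"
      using eventually_gt_at_top[of 0]
    proof eventually_elim
      case (elim x)
      have "\<bar>(?F x - L * ?G x) * ?w x\<bar> = \<bar>?F x - L * ?G x\<bar> * ?w x"
        by (simp add: abs_mult)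
      also have "\<dots> \<le> ((\<Sum>n<N. \<bar>d n\<bar> * x ^ n / fact n) + (e / 4) * ?G x) * ?w x"
        using N[of x] elim by (intro mult_right_mono) auto
      also have "\<dots> = (\<Sum>n<N. \<bar>d n\<bar> / fact n * (x ^ n * ?w x)) + (e / 4) * (?G x * ?w x)"
        by (simp add: algebra_simps sum_distrib_left sum_distrib_right)
      also have "\<dots> < e / 2 + (e / 4) * 2"
        using elim e by (intro add_strict_mono mult_strict_left_mono) auto
      finally show ?case by simp
    qed
  qed
  from tendsto_add[OF this tendsto_mult[OF tendsto_const[of L] lim_g]]
  show ?thesis by (simp add: algebra_simps)
qed

lemma summable_powr_exp_series:
  fixes x c :: real
  shows "summable (\<lambda>n. real (n + 1) powr c * x ^ n / fact n)"
proof (cases "x = 0")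
  case True
  then show ?thesis
    by (intro summable_finite[of "{0}"]) auto
next
  case False
  let ?f = "\<lambda>n. real (n + 1) powr c * x ^ n / fact n"
  have "(\<lambda>n. (real (n + 2) / real (n + 1)) powr c * (\<bar>x\<bar> / real (n + 1))) \<longlonglongrightarrow> 0"
    by real_asymp
  then have "\<forall>\<^sub>F n in sequentially. (real (n + 2) / real (n + 1)) powr c * (\<bar>x\<bar> / real (n + 1)) < 1 / 2"
    by (rule order_tendstoD) simp
  then obtain N where N: "\<And>n. n \<ge> N \<Longrightarrow> (real (n + 2) / real (n + 1)) powr c * (\<bar>x\<bar> / real (n + 1)) < 1 / 2"
    by (auto simp: eventually_sequentially)
  show ?thesis
  proof (rule summable_ratio_test[of "1/2" N])
    fix n assume "n \<ge> N"
    have "norm (?f (Suc n)) = ((real (n + 2) / real (n + 1)) powr c * (\<bar>x\<bar> / real (n + 1))) * norm (?f n)"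
      by (simp add: abs_mult powr_divide power_abs divide_simps)
    also have "\<dots> \<le> 1 / 2 * norm (?f n)"
      using N[OF \<open>n \<ge> N\<close>] by (intro mult_right_mono) auto
    finally show "norm (?f (Suc n)) \<le> 1 / 2 * norm (?f n)" .
  qed simp
qed

text \<open>The base \<open>n + 1\<close> keeps all coefficients positive for every real
  \<open>c\<close>, as is needed of a comparison series.\<close>

definition powr_exp_series :: "real \<Rightarrow> real \<Rightarrow> real" where
  "powr_exp_series c x = (\<Sum>n. real (n + 1) powr c * x ^ n / fact n)"

text \<open>This is the \<open>c\<close>-th moment of \<open>(N + 1) / x\<close> for a Poisson variable \<open>N\<close> of mean \<open>x\<close>.\<close>

abbreviation exp_series_moment :: "real \<Rightarrow> real \<Rightarrow> real" where
  "exp_series_moment c x \<equiv> powr_exp_series c x * (exp (- x) * x powr (- c))"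

lemma powr_exp_series_shift:
  assumes "x > 0"
  shows "(\<lambda>n. real n powr (c + 1) * x ^ n / fact n) sums (x * powr_exp_series c x)"
proof -
  have "(\<lambda>n. x * (real (n + 1) powr c * x ^ n / fact n)) sums (x * powr_exp_series c x)"
    unfolding powr_exp_series_def by (intro sums_mult summable_sums summable_powr_exp_series)
  moreover have "x * (real (n + 1) powr c * x ^ n / fact n)
      = real (Suc n) powr (c + 1) * x ^ Suc n / fact (Suc n)" for n
    by (simp add: powr_add divide_simps)
  ultimately have "(\<lambda>n. real (Suc n) powr (c + 1) * x ^ Suc n / fact (Suc n)) sums (x * powr_exp_series c x)"
    by simp
  then show ?thesis
    \<comment> \<open>the term for \<open>n = 0\<close> is 0, because \<open>0 powr y = 0\<close> for every \<open>y\<close>\<close>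
    by (subst (asm) sums_Suc_iff) simp
qed

text \<open>The series with coefficients \<open>real n powr (c + 1)\<close> links the two sides: an
  index shift makes it exactly \<open>x * powr_exp_series c x\<close>, while its coefficients are
  asymptotic to those of exponent \<open>c + 1\<close>. The Abelian comparison is applied once in
  each direction.\<close>

lemma exp_series_moment_step:
  "(exp_series_moment (c + 1) \<longlongrightarrow> 1) at_top \<longleftrightarrow> (exp_series_moment c \<longlongrightarrow> 1) at_top"
proof -
  let ?S = "\<lambda>x. \<Sum>n. real n powr (c + 1) * x ^ n / fact n"
  have S: "?S x = x * powr_exp_series c x" if "x > 0" for x
    using powr_exp_series_shift[OF that, of c] by (simp add: sums_iff)
  have eq: "\<forall>\<^sub>F x in at_top. ?S x * (exp (- x) * x powr (- (c + 1))) = exp_series_moment c x"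
    using eventually_gt_at_top[of 0]
    proof eventually_elim
      case (elim x)
      have "x powr (- (c + 1)) = x powr (- c) / x"
        using elim powr_diff[of x "- c" 1] by simp
      then show ?case using S[of x] elim by simp
    qed
  have iff: "((\<lambda>x. ?S x * (exp (- x) * x powr (- (c + 1)))) \<longlongrightarrow> 1) at_top
      \<longleftrightarrow> (exp_series_moment c \<longlongrightarrow> 1) at_top"
    by (rule tendsto_cong[OF eq])
  show ?thesis
  proof
    assume "(exp_series_moment (c + 1) \<longlongrightarrow> 1) at_top"
    then have "((\<lambda>x. ?S x * (exp (- x) * x powr (- (c + 1)))) \<longlongrightarrow> 1) at_top"
      unfolding powr_exp_series_def
    \<comment> \<open>The rotation puts the limit hypothesis on the comparison series first, to be
      met by the chained fact.\<close>
    proof (rule exp_series_abelian[rotated 4])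
      show "(\<lambda>n. real n powr (c + 1) / real (n + 1) powr (c + 1)) \<longlonglongrightarrow> 1"
        by real_asymp
    qed (use summable_powr_exp_series in auto)
    then show "(exp_series_moment c \<longlongrightarrow> 1) at_top" using iff by simp
  next
    assume "(exp_series_moment c \<longlongrightarrow> 1) at_top"
    then have "((\<lambda>x. ?S x * (exp (- x) * x powr (- (c + 1)))) \<longlongrightarrow> 1) at_top" using iff by simp
    then show "(exp_series_moment (c + 1) \<longlongrightarrow> 1) at_top"
      unfolding powr_exp_series_def
    proof (rule exp_series_abelian[rotated 4])
      show "(\<lambda>n. real (n + 1) powr (c + 1) / real n powr (c + 1)) \<longlonglongrightarrow> 1"
        by real_asymp
      show "\<forall>\<^sub>F n in sequentially. 0 < real n powr (c + 1)"
        using eventually_gt_at_top[of 0] by eventually_elim auto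
      show "summable (\<lambda>n. real n powr (c + 1) * x ^ n / fact n)" if "x > 0" for x
        using powr_exp_series_shift[OF that, of c] by (simp add: sums_iff)
    qed auto
  qed
qed

lemma exp_series_moment_int: "(exp_series_moment (of_int m) \<longlongrightarrow> 1) at_top"
proof (induction m rule: int_induct[where k = 0])
  case base
  have "powr_exp_series 0 x = exp x" for x
    by (simp add: powr_exp_series_def exp_def field_simps scaleR_conv_of_real)
  then have "exp_series_moment 0 x = 1" if "x > 0" for x
    using that by (simp add: exp_minus)
  then have "\<forall>\<^sub>F x in at_top. exp_series_moment 0 x = 1"
    by (rule eventually_mono[OF eventually_gt_at_top[of 0]])
  then show ?case by (simp add: tendsto_eventually)
next
  case (step1 i)
  then show ?case using exp_series_moment_step[of "of_int i"] by simp
next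
  case (step2 i)
  then show ?case using exp_series_moment_step[of "of_int (i - 1)"] by simp
qed

text \<open>Weighted AM-GM, with \<open>c\<close> written as a convex combination of
  \<open>m\<close> and \<open>m + 1\<close>. The bound is an equality at \<open>y = 1\<close>, the
  point at which \<open>(n + 1) / x\<close> concentrates.\<close>

lemma powr_between_int_le:
  fixes y c :: real and m :: int
  assumes "y > 0" "of_int m \<le> c" "c \<le> of_int m + 1"
  shows "y powr c \<le> (of_int m + 1 - c) * y powr of_int m + (c - of_int m) * y powr (of_int m + 1)"
proof -
  have c: "c = of_int m * (of_int m + 1 - c) + (of_int m + 1) * (c - of_int m)"
    by (simp add: algebra_simps)
  have "y powr c = (y powr of_int m) powr (of_int m + 1 - c) * (y powr (of_int m + 1)) powr (c - of_int m)"
    by (subst c, subst powr_add) (simp only: powr_powr)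
  also have "\<dots> \<le> (of_int m + 1 - c) * y powr of_int m + (c - of_int m) * y powr (of_int m + 1)"
    by (rule Youngs_inequality_0) (use assms in auto)
  finally show ?thesis .
qed

text \<open>Here the interior exponent is \<open>m + 1\<close>, lying between \<open>c\<close> and
  \<open>m + 2\<close>; the AM-GM bound for it is solved for \<open>y powr c\<close>. Again equality
  holds at \<open>y = 1\<close>.\<close>

lemma powr_between_int_ge:
  fixes y c :: real and m :: int
  assumes "y > 0" "of_int m \<le> c" "c \<le> of_int m + 1"
  shows "(of_int m + 2 - c) * y powr (of_int m + 1) - (of_int m + 1 - c) * y powr (of_int m + 2) \<le> y powr c"
proof -
  \<comment> \<open>The weight for which \<open>m + 1 = c * l + (m + 2) * (1 - l)\<close>.\<close>
  define l where "l = 1 / (of_int m + 2 - c)"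
  have l: "0 < l" "l \<le> 1" "l * (of_int m + 2 - c) = 1"
    using assms by (auto simp: l_def)
  have e: "of_int m + 1 = c * l + (of_int m + 2) * (1 - l)"
    using l(3) by (simp add: algebra_simps)
  have "y powr (of_int m + 1) = (y powr c) powr l * (y powr (of_int m + 2)) powr (1 - l)"
    by (subst e, subst powr_add) (simp only: powr_powr)
  also have "\<dots> \<le> l * y powr c + (1 - l) * y powr (of_int m + 2)"
    by (rule Youngs_inequality_0) (use assms l in auto)
  finally have "(of_int m + 2 - c) * y powr (of_int m + 1)
      \<le> (of_int m + 2 - c) * (l * y powr c + (1 - l) * y powr (of_int m + 2))"
    using assms by (intro mult_left_mono) auto
  also have "\<dots> = (l * (of_int m + 2 - c)) * y powr c
      + (of_int m + 2 - c - l * (of_int m + 2 - c)) * y powr (of_int m + 2)"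
    by (simp add: algebra_simps)
  also have "\<dots> = y powr c + (of_int m + 1 - c) * y powr (of_int m + 2)"
    by (simp add: l(3))
  finally show ?thesis by simp
qed

text \<open>With the Poisson weights explicit, a pointwise inequality between powers of
  \<open>(n + 1) / x\<close> passes to the moments.\<close>

lemma exp_series_moment_sums:
  assumes "x > 0"
  shows "(\<lambda>n. (real (n + 1) / x) powr c * (exp (- x) * (x ^ n / fact n))) sums exp_series_moment c x"
proof -
  have "(\<lambda>n. real (n + 1) powr c * x ^ n / fact n * (exp (- x) * x powr (- c))) sums exp_series_moment c x"
    unfolding powr_exp_series_def by (intro sums_mult2 summable_sums summable_powr_exp_series)
  moreover have "(real (n + 1) / x) powr c = real (n + 1) powr c * x powr (- c)" for n
    using assms by (subst powr_divide) (auto simp: powr_minus divide_inverse)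
  ultimately show ?thesis
    by (simp only: mult_ac times_divide_eq_right)
qed

text \<open>Averaging the two pointwise bounds squeezes the moment between combinations of integer
  moments. All of these tend to 1, and the coefficients of each combination add up to 1.\<close>

lemma exp_series_moment_tendsto: "(exp_series_moment c \<longlongrightarrow> 1) at_top"
proof -
  define m where "m = \<lfloor>c\<rfloor>"
  have m: "of_int m \<le> c" "c \<le> of_int m + 1"
    unfolding m_def by linarith+
  have lim: "(exp_series_moment (of_int m) \<longlongrightarrow> 1) at_top"
    "(exp_series_moment (of_int m + 1) \<longlongrightarrow> 1) at_top"
    "(exp_series_moment (of_int m + 2) \<longlongrightarrow> 1) at_top"
    using exp_series_moment_int[of m] exp_series_moment_int[of "m + 1"] exp_series_moment_int[of "m + 2"]
    by simp_all
  show ?thesis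
  proof (rule tendsto_sandwich)
    show "\<forall>\<^sub>F x in at_top. (of_int m + 2 - c) * exp_series_moment (of_int m + 1) x
        - (of_int m + 1 - c) * exp_series_moment (of_int m + 2) x \<le> exp_series_moment c x"
      using eventually_gt_at_top[of 0]
    proof eventually_elim
      case (elim x)
      show ?case
      proof (rule sums_le[OF _ sums_diff[OF sums_mult[OF exp_series_moment_sums[OF elim]]
            sums_mult[OF exp_series_moment_sums[OF elim]]] exp_series_moment_sums[OF elim]])
        show "(of_int m + 2 - c) * ((real (n + 1) / x) powr (of_int m + 1) * (exp (- x) * (x ^ n / fact n)))
            - (of_int m + 1 - c) * ((real (n + 1) / x) powr (of_int m + 2) * (exp (- x) * (x ^ n / fact n)))
            \<le> (real (n + 1) / x) powr c * (exp (- x) * (x ^ n / fact n))" for n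
        proof -
          have "0 < real (n + 1) / x" "0 \<le> exp (- x) * (x ^ n / fact n)"
            using elim by auto
          from mult_right_mono[OF powr_between_int_ge[OF this(1) m] this(2)]
          show ?thesis by (simp only: left_diff_distrib mult.assoc)
        qed
      qed
    qed
    show "\<forall>\<^sub>F x in at_top. exp_series_moment c x \<le> (of_int m + 1 - c) * exp_series_moment (of_int m) x
        + (c - of_int m) * exp_series_moment (of_int m + 1) x"
      using eventually_gt_at_top[of 0]
    proof eventually_elim
      case (elim x)
      show ?case
      proof (rule sums_le[OF _ exp_series_moment_sums[OF elim] sums_add[OF sums_mult[OF
            exp_series_moment_sums[OF elim]] sums_mult[OF exp_series_moment_sums[OF elim]]]])
        show "(real (n + 1) / x) powr c * (exp (- x) * (x ^ n / fact n)) \<le>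
            (of_int m + 1 - c) * ((real (n + 1) / x) powr (of_int m) * (exp (- x) * (x ^ n / fact n)))
            + (c - of_int m) * ((real (n + 1) / x) powr (of_int m + 1) * (exp (- x) * (x ^ n / fact n)))" for n
        proof -
          have "0 < real (n + 1) / x" "0 \<le> exp (- x) * (x ^ n / fact n)"
            using elim by auto
          from mult_right_mono[OF powr_between_int_le[OF this(1) m] this(2)]
          show ?thesis by (simp only: distrib_right mult.assoc)
        qed
      qed
    qed
    have "((\<lambda>x. (of_int m + 2 - c) * exp_series_moment (of_int m + 1) x
        - (of_int m + 1 - c) * exp_series_moment (of_int m + 2) x)
        \<longlongrightarrow> (of_int m + 2 - c) * 1 - (of_int m + 1 - c) * 1) at_top"
      by (intro tendsto_intros lim)
    then show "((\<lambda>x. (of_int m + 2 - c) * exp_series_moment (of_int m + 1) x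
        - (of_int m + 1 - c) * exp_series_moment (of_int m + 2) x) \<longlongrightarrow> 1) at_top"
      by simp
    have "((\<lambda>x. (of_int m + 1 - c) * exp_series_moment (of_int m) x
        + (c - of_int m) * exp_series_moment (of_int m + 1) x)
        \<longlongrightarrow> (of_int m + 1 - c) * 1 + (c - of_int m) * 1) at_top"
      by (intro tendsto_intros lim)
    then show "((\<lambda>x. (of_int m + 1 - c) * exp_series_moment (of_int m) x
        + (c - of_int m) * exp_series_moment (of_int m + 1) x) \<longlongrightarrow> 1) at_top"
      by simp
  qed
qed

section \<open>Kummer's function\<close>

lemma pochhammer_nonzero:
  fixes b :: "'a :: field_char_0"
  shows "b \<notin> \<int>\<^sub>\<le>\<^sub>0 \<Longrightarrow> pochhammer b n \<noteq> 0"
  using pochhammer_eq_0_imp_nonpos_Int by blast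

lemma summable_kummerM:
  fixes a b x :: real
  assumes b: "b \<notin> \<int>\<^sub>\<le>\<^sub>0"
  shows "summable (\<lambda>n. pochhammer a n / pochhammer b n * x ^ n / fact n)"
proof -
  let ?f = "\<lambda>n. pochhammer a n / pochhammer b n * x ^ n / fact n"
  have "(\<lambda>n. \<bar>(a + real n) / (b + real n)\<bar> * (\<bar>x\<bar> / real (n + 1))) \<longlonglongrightarrow> 0"
    by real_asymp
  then have "\<forall>\<^sub>F n in sequentially. \<bar>(a + real n) / (b + real n)\<bar> * (\<bar>x\<bar> / real (n + 1)) < 1 / 2"
    by (rule order_tendstoD) simp
  then obtain N where N: "\<And>n. n \<ge> N \<Longrightarrow> \<bar>(a + real n) / (b + real n)\<bar> * (\<bar>x\<bar> / real (n + 1)) < 1 / 2"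
    by (auto simp: eventually_sequentially)
  show ?thesis
  proof (rule summable_ratio_test[of "1/2" N])
    fix n assume "n \<ge> N"
    have "norm (?f (Suc n)) = (\<bar>(a + real n) / (b + real n)\<bar> * (\<bar>x\<bar> / real (n + 1))) * norm (?f n)"
      by (simp add: pochhammer_Suc abs_mult power_abs mult_ac)
    also have "\<dots> \<le> 1 / 2 * norm (?f n)"
      using N[OF \<open>n \<ge> N\<close>] by (intro mult_right_mono) auto
    finally show "norm (?f (Suc n)) \<le> 1 / 2 * norm (?f n)" .
  qed simp
qed

lemma kummerM_sums:
  assumes "b \<notin> \<int>\<^sub>\<le>\<^sub>0"
  shows "(\<lambda>n. pochhammer a n / pochhammer b n / fact n * x ^ n) sums kummerM a b x"
  using summable_sums[OF summable_kummerM[OF assms, of a x]]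
  by (simp add: kummerM_def field_simps)

lemma kummerM_0 [simp]: "kummerM a b 0 = 1"
  using powser_sums_zero[of "\<lambda>n. pochhammer a n / pochhammer b n / fact n"]
  by (simp add: kummerM_def sums_iff field_simps)

lemma kummerM_coeff_Suc:
  fixes a b :: real
  shows "a / b * (pochhammer (a + 1) n / pochhammer (b + 1) n / fact n)
    = real (Suc n) * (pochhammer a (Suc n) / pochhammer b (Suc n) / fact (Suc n))"
  by (simp add: pochhammer_rec divide_simps del: of_nat_Suc)

lemma has_real_derivative_kummerM:
  assumes "b \<notin> \<int>\<^sub>\<le>\<^sub>0"
  shows "(kummerM a b has_real_derivative a / b * kummerM (a + 1) (b + 1) x) (at x)"
proof -
  let ?c = "\<lambda>n. pochhammer a n / pochhammer b n / fact n"
  have b1: "b + 1 \<notin> \<int>\<^sub>\<le>\<^sub>0"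
    using plus_one_in_nonpos_Ints_imp assms by blast
  have "((\<lambda>x. \<Sum>n. ?c n * x ^ n) has_field_derivative (\<Sum>n. diffs ?c n * x ^ n)) (at x)"
    using kummerM_sums[OF assms] by (intro termdiffs_strong_converges_everywhere) (auto simp: sums_iff)
  moreover have "(\<lambda>x. \<Sum>n. ?c n * x ^ n) = kummerM a b"
    using kummerM_sums[OF assms] by (auto simp: sums_iff)
  moreover have "(\<lambda>n. diffs ?c n * x ^ n) sums (a / b * kummerM (a + 1) (b + 1) x)"
    using sums_mult[OF kummerM_sums[OF b1, of "a + 1" x], of "a / b"]
    by (simp only: diffs_def kummerM_coeff_Suc mult.assoc[symmetric])
  ultimately show ?thesis by (simp add: sums_iff)
qed

text \<open>Comparing coefficients of \<open>x ^ n\<close> reduces the equation to the recurrence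
  \<open>(n + 1) (b + n) c (n + 1) = (a + n) c n\<close>. The products with parameters
  \<open>a + 1\<close> and \<open>a + 2\<close> are the first and second derivatives.\<close>

lemma kummerM_ode:
  assumes b: "b \<notin> \<int>\<^sub>\<le>\<^sub>0"
  shows "x * (a / b * ((a + 1) / (b + 1) * kummerM (a + 2) (b + 2) x))
    + (b - x) * (a / b * kummerM (a + 1) (b + 1) x) - a * kummerM a b x = 0"
proof -
  define c where "c n = pochhammer a n / pochhammer b n / fact n" for n
  define M1 M2 where "M1 = a / b * kummerM (a + 1) (b + 1) x"
    and "M2 = a / b * ((a + 1) / (b + 1) * kummerM (a + 2) (b + 2) x)"
  have b1: "b + 1 \<notin> \<int>\<^sub>\<le>\<^sub>0" and b2: "b + 2 \<notin> \<int>\<^sub>\<le>\<^sub>0"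
    using plus_one_in_nonpos_Ints_imp[of b] plus_one_in_nonpos_Ints_imp[of "b + 1"] b by (auto simp: add.assoc)
  \<comment> \<open>This is the operator \<open>x * d/dx\<close> on coefficients; the new constant
    term vanishes because of the factor \<open>real n\<close>.\<close>
  have shift: "(\<lambda>n. real n * f n * x ^ n) sums (x * S)"
    if "(\<lambda>n. real (Suc n) * f (Suc n) * x ^ n) sums S" for f :: "nat \<Rightarrow> real" and S
  proof -
    have "(\<lambda>n. real (Suc n) * f (Suc n) * x ^ Suc n) sums (x * S)"
      using sums_mult[OF that, of x] by (simp add: mult_ac)
    then show ?thesis by (subst (asm) sums_Suc_iff) simp
  qed
  have M0: "(\<lambda>n. c n * x ^ n) sums kummerM a b x"
    unfolding c_def by (rule kummerM_sums[OF b])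
  have M1: "(\<lambda>n. real (Suc n) * c (Suc n) * x ^ n) sums M1"
    using sums_mult[OF kummerM_sums[OF b1, of "a + 1" x], of "a / b"]
    by (simp only: c_def M1_def kummerM_coeff_Suc mult.assoc[symmetric])
  have "a / b * ((a + 1) / (b + 1) * (pochhammer (a + 2) n / pochhammer (b + 2) n / fact n))
      = real (Suc n) * (real (Suc (Suc n)) * c (Suc (Suc n)))" for n
  proof -
    have "(a + 1) / (b + 1) * (pochhammer (a + 2) n / pochhammer (b + 2) n / fact n)
      = real (Suc n) * (pochhammer (a + 1) (Suc n) / pochhammer (b + 1) (Suc n) / fact (Suc n))"
      using kummerM_coeff_Suc[of "a + 1" "b + 1" n] by (simp add: add.assoc)
    then show ?thesis
      unfolding c_def kummerM_coeff_Suc[of a b "Suc n", symmetric] by (simp only: mult.left_commute)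
  qed
  then have M2: "(\<lambda>n. real (Suc n) * (real (Suc (Suc n)) * c (Suc (Suc n))) * x ^ n) sums M2"
    using sums_mult[OF sums_mult[OF kummerM_sums[OF b2, of "a + 2" x], of "(a + 1) / (b + 1)"], of "a / b"]
    by (simp only: M2_def mult.assoc[symmetric])
  have rec: "real (Suc n) * (b + real n) * c (Suc n) = (a + real n) * c n" for n
    using pochhammer_nonzero[OF b, of "Suc n"]
    by (simp add: c_def pochhammer_Suc divide_simps del: of_nat_Suc)
  have "(\<lambda>n. real n * (real (Suc n) * c (Suc n)) * x ^ n + b * (real (Suc n) * c (Suc n) * x ^ n)
      - real n * c n * x ^ n - a * (c n * x ^ n)) sums (x * M2 + b * M1 - x * M1 - a * kummerM a b x)"
    by (intro sums_add sums_diff sums_mult M0 M1 shift[OF M1]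
        shift[of "\<lambda>n. real (Suc n) * c (Suc n)", OF M2])
  moreover have "real n * (real (Suc n) * c (Suc n)) * x ^ n + b * (real (Suc n) * c (Suc n) * x ^ n)
      - real n * c n * x ^ n - a * (c n * x ^ n)
      = (real (Suc n) * (b + real n) * c (Suc n) - (a + real n) * c n) * x ^ n" for n
    by (simp add: algebra_simps del: of_nat_Suc)
  ultimately have "(\<lambda>n. 0) sums (x * M2 + b * M1 - x * M1 - a * kummerM a b x)"
    by (simp add: rec del: of_nat_Suc)
  then have "x * M2 + b * M1 - x * M1 - a * kummerM a b x = 0"
    using sums_unique2 sums_zero by blast
  then show ?thesis
    unfolding M1_def[symmetric] M2_def[symmetric] by (simp add: left_diff_distrib)
qed

section \<open>Kummer's transformation\<close>

lemma pochhammer_minus_of_nat: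
  assumes "i \<le> n"
  shows "pochhammer (- of_nat n) i = ((- 1) ^ i * fact n / fact (n - i) :: 'a :: field_char_0)"
proof -
  have "fact n = (pochhammer 1 (n - i) * pochhammer (1 + of_nat (n - i)) i :: 'a)"
    using pochhammer_product[of "n - i" n "1 :: 'a"] assms by (simp add: pochhammer_fact)
  then show ?thesis
    using assms by (simp add: pochhammer_minus pochhammer_fact[symmetric] of_nat_diff add_ac)
qed

text \<open>The right-hand side is a Cauchy product of two absolutely convergent series, and its
  coefficients are evaluated by the Chu-Vandermonde sum.\<close>

lemma kummer_transformation:
  assumes b: "b \<notin> \<int>\<^sub>\<le>\<^sub>0"
  shows "kummerM a b (- x) = exp (- x) * kummerM (b - a) b x"
proof -
  define u where "u n = pochhammer (b - a) n / pochhammer b n / fact n * x ^ n" for n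
  define v where "v n = (- x) ^ n / fact n" for n :: nat
  have "summable (\<lambda>n. norm (u n))"
    unfolding u_def
    by (rule powser_insidea[where x = "\<bar>x\<bar> + 1"]) (use kummerM_sums[OF b] in \<open>auto simp: sums_iff\<close>)
  moreover have "summable (\<lambda>n. norm (v n))"
    unfolding v_def using summable_norm_exp[of "- x"] by (simp add: divide_inverse mult_ac)
  ultimately have "(\<lambda>n. \<Sum>i\<le>n. u i * v (n - i)) sums ((\<Sum>n. u n) * (\<Sum>n. v n))"
    by (rule Cauchy_product_sums)
  moreover have "(\<Sum>n. u n) = kummerM (b - a) b x"
    using kummerM_sums[OF b] by (auto simp: u_def sums_iff)
  moreover have "(\<Sum>n. v n) = exp (- x)"
    by (simp add: v_def exp_def divide_inverse mult_ac)
  moreover have "(\<Sum>i\<le>n. u i * v (n - i)) = pochhammer a n / pochhammer b n / fact n * (- x) ^ n" for n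
  proof -
    \<comment> \<open>The reciprocal of \<open>fact (n - i)\<close> becomes
      \<open>pochhammer (- of_nat n) i\<close> up to sign and \<open>fact n\<close>, which gives a
      terminating hypergeometric sum at 1.\<close>
    have "u i * v (n - i) = (- x) ^ n / fact n
        * (pochhammer (b - a) i * pochhammer (- of_nat n) i / (of_nat (fact i) * pochhammer b i))"
      if "i \<le> n" for i
    proof -
      have "(- x) ^ n = (- x) ^ i * (- x) ^ (n - i)"
        using that by (simp flip: power_add)
      also have "(- x) ^ i = (- 1) ^ i * x ^ i"
        by (rule power_minus)
      finally have "x ^ i * (- x) ^ (n - i) = (- x) ^ n * (- 1) ^ i"
        by simp
      then show ?thesis
        using that by (simp add: u_def v_def pochhammer_minus_of_nat mult_ac)
    qed
    then have "(\<Sum>i\<le>n. u i * v (n - i)) = (- x) ^ n / fact n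
        * (\<Sum>i\<le>n. pochhammer (b - a) i * pochhammer (- of_nat n) i / (of_nat (fact i) * pochhammer b i))"
      by (simp add: sum_distrib_left)
    also have "(\<Sum>i\<le>n. pochhammer (b - a) i * pochhammer (- of_nat n) i / (of_nat (fact i) * pochhammer b i))
        = pochhammer a n / pochhammer b n"
      using Vandermonde_pochhammer[of n b "b - a"] b by (force simp: atLeast0AtMost)
    finally show ?thesis by (simp add: mult_ac)
  qed
  ultimately have "(\<lambda>n. pochhammer a n / pochhammer b n / fact n * (- x) ^ n) sums
      (kummerM (b - a) b x * exp (- x))"
    by simp
  then show ?thesis
    using sums_unique2[OF kummerM_sums[OF b]] by (simp add: mult.commute)
qed

section \<open>Growth of Kummer's function at infinity\<close>

lemma pochhammer_ratio_asymp:
  fixes a b :: real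
  assumes b: "b \<notin> \<int>\<^sub>\<le>\<^sub>0"
  shows "(\<lambda>n. pochhammer a n / pochhammer b n / real (n + 1) powr (a - b)) \<longlonglongrightarrow> Gamma b * rGamma a"
\<comment> \<open>The Euler limits for \<open>Gamma b\<close> and \<open>rGamma a\<close> contain
  \<open>pochhammer\<close> at index \<open>n + 1\<close>, hence the shift by one. The extra factor
  replaces the power of \<open>n\<close> by that of \<open>n + 2\<close>; using
  \<open>rGamma\<close> also covers the poles of \<open>Gamma\<close> at \<open>a\<close>.\<close>
proof (rule LIMSEQ_imp_Suc)
  have "(\<lambda>n. (Gamma_series b n * rGamma_series a n) * (real n / real (n + 2)) powr (a - b))
      \<longlonglongrightarrow> (Gamma b * rGamma a) * 1"
  proof (intro tendsto_mult)
    show "(\<lambda>n. (real n / real (n + 2)) powr (a - b)) \<longlonglongrightarrow> 1"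
      by real_asymp
  qed (rule Gamma_series_LIMSEQ rGamma_series_LIMSEQ)+
  moreover have "\<forall>\<^sub>F n in sequentially.
      (Gamma_series b n * rGamma_series a n) * (real n / real (n + 2)) powr (a - b)
      = pochhammer a (Suc n) / pochhammer b (Suc n) / real (Suc n + 1) powr (a - b)"
    using eventually_gt_at_top[of 0]
  proof eventually_elim
    case (elim n)
    have "exp (b * ln (real n)) = real n powr b" "exp (a * ln (real n)) = real n powr a"
      using elim by (auto simp: powr_def)
    moreover have "(real n / real (n + 2)) powr (a - b) = real n powr a / real n powr b / real (n + 2) powr (a - b)"
      using elim by (subst powr_divide) (auto simp: powr_diff)
    ultimately show ?case
      using elim by (simp add: Gamma_series_def rGamma_series_def)
  qed
  ultimately show "(\<lambda>n. pochhammer a (Suc n) / pochhammer b (Suc n) / real (Suc n + 1) powr (a - b))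
      \<longlonglongrightarrow> Gamma b * rGamma a"
    using Lim_transform_eventually by fastforce
qed

lemma kummerM_asymp_at_top:
  assumes b: "b \<notin> \<int>\<^sub>\<le>\<^sub>0"
  shows "((\<lambda>x. kummerM a b x * (exp (- x) * x powr (b - a))) \<longlongrightarrow> Gamma b * rGamma a) at_top"
proof -
  have "((\<lambda>x. kummerM a b x * (exp (- x) * x powr (- (a - b)))) \<longlongrightarrow> Gamma b * rGamma a) at_top"
    unfolding kummerM_def
  proof (rule exp_series_abelian[OF _ _ _ pochhammer_ratio_asymp[OF b]])
    show "((\<lambda>x. (\<Sum>n. real (n + 1) powr (a - b) * x ^ n / fact n) * (exp (- x) * x powr - (a - b))) \<longlongrightarrow> 1) at_top"
      using exp_series_moment_tendsto[of "a - b"] by (simp add: powr_exp_series_def)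
  qed (use summable_powr_exp_series in auto)
  then show ?thesis by simp
qed

text \<open>The substitution of \<open>inverse x\<close> reduces this to the one-sided rule at 0;
  the common chain rule factor \<open>- 1 / x^2\<close> cancels in the quotient.\<close>

lemma lhopital_0_at_top:
  fixes f g :: "real \<Rightarrow> real"
  assumes f_0: "(f \<longlongrightarrow> 0) at_top"
    and g_0: "(g \<longlongrightarrow> 0) at_top"
    and g: "eventually (\<lambda>x. g x \<noteq> 0) at_top"
    and g': "eventually (\<lambda>x. g' x \<noteq> 0) at_top"
    and Df: "eventually (\<lambda>x. DERIV f x :> f' x) at_top"
    and Dg: "eventually (\<lambda>x. DERIV g x :> g' x) at_top"
    and lim: "((\<lambda> x. (f' x / g' x)) \<longlongrightarrow> L) at_top"
  shows "((\<lambda> x. f x / g x) \<longlongrightarrow> L) at_top"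
proof -
  have D: "\<forall>\<^sub>F x in at_right 0. DERIV (\<lambda>x. h (inverse x)) x :> - h' (inverse x) / x\<^sup>2"
    if "\<forall>\<^sub>F x in at_top. DERIV h x :> h' x" for h h' :: "real \<Rightarrow> real"
    unfolding eventually_at_right_to_top
    using that eventually_gt_at_top[of 0]
  proof eventually_elim
    case (elim x)
    have "DERIV inverse (inverse x) :> - (x\<^sup>2)"
      using DERIV_inverse[of "inverse x"] elim by (simp add: power2_eq_square)
    from DERIV_chain2[OF _ this, of h "h' x"] show ?case
      using elim by (simp add: field_simps)
  qed
  have "((\<lambda>x. f (inverse x) / g (inverse x)) \<longlongrightarrow> L) (at_right 0)"
  proof (rule lhopital_right_0[OF _ _ _ _ D[OF Df] D[OF Dg]])
    have "((\<lambda>x. f' (inverse x) / g' (inverse x)) \<longlongrightarrow> L) (at_right 0)"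
      using lim by (simp add: filterlim_at_top_to_right)
    moreover have "\<forall>\<^sub>F x in at_right 0. f' (inverse x) / g' (inverse x)
        = (- f' (inverse x) / x\<^sup>2) / (- g' (inverse x) / x\<^sup>2)"
      using eventually_at_right_less[of 0] by eventually_elim simp
    ultimately show "((\<lambda>x. (- f' (inverse x) / x\<^sup>2) / (- g' (inverse x) / x\<^sup>2)) \<longlongrightarrow> L) (at_right 0)"
      by (rule Lim_transform_eventually)
    show "\<forall>\<^sub>F x in at_right 0. - g' (inverse x) / x\<^sup>2 \<noteq> 0"
      unfolding eventually_at_right_to_top using g' eventually_gt_at_top[of 0] by eventually_elim simp
  qed (use f_0 g_0 g in \<open>simp_all add: filterlim_at_top_to_right eventually_at_right_to_top\<close>)
  then show ?thesis by (simp add: filterlim_at_top_to_right)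
qed

section \<open>The equation of the similarity profile\<close>

text \<open>The second-order equation as a first-order system. With \<open>w'\<close> an explicit
  function, second derivatives can be eliminated by rewriting.\<close>

definition cubic_ode :: "real \<Rightarrow> (real \<Rightarrow> real) \<Rightarrow> (real \<Rightarrow> real) \<Rightarrow> bool" where
  "cubic_ode a w w' \<longleftrightarrow> (\<forall>t. (w has_real_derivative w' t) (at t) \<and>
     (w' has_real_derivative - (t\<^sup>2 / 3) * w' t - a * t * w t) (at t))"

lemma cubic_odeD:
  assumes "cubic_ode a w w'"
  shows "(w has_real_derivative w' t) (at t)"
    and "(w' has_real_derivative - (t\<^sup>2 / 3) * w' t - a * t * w t) (at t)"
  using assms by (auto simp: cubic_ode_def)

lemma cubic_ode_lincomb:
  assumes u: "cubic_ode a u u'" and w: "cubic_ode a w w'"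
  shows "cubic_ode a (\<lambda>t. p * u t - q * w t) (\<lambda>t. p * u' t - q * w' t)"
  unfolding cubic_ode_def
  by (auto intro!: derivative_eq_intros cubic_odeD[OF u] cubic_odeD[OF w] simp: field_simps)

text \<open>Abel's identity: the coefficient of \<open>w'\<close> in the equation is
  \<open>t^2 / 3\<close>, so the Wronskian times \<open>exp (t^3 / 9)\<close> is constant.\<close>

lemma cubic_ode_wronskian:
  assumes u: "cubic_ode a u u'" and w: "cubic_ode a w w'"
  shows "u t * w' t - u' t * w t = (u 0 * w' 0 - u' 0 * w 0) * exp (- (t^3) / 9)"
proof -
  define D where "D t = (u t * w' t - u' t * w t) * exp (t^3 / 9)" for t
  have "(D has_real_derivative 0) (at t)" for t
    unfolding D_def
    by (auto intro!: derivative_eq_intros cubic_odeD[OF u] cubic_odeD[OF w])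
       (simp add: field_simps power2_eq_square)
  then have "D t = D 0"
    by (intro DERIV_isconst_all) blast
  then show ?thesis
    by (simp add: D_def exp_minus field_simps)
qed

definition cubic_sol1 :: "real \<Rightarrow> real \<Rightarrow> real" where
  "cubic_sol1 a t = kummerM a (2/3) (- (t^3) / 9)"

text \<open>The second Frobenius solution \<open>zeta^(1-b) M(a-b+1, 2-b, zeta)\<close> at
  \<open>b = 2/3\<close>, with the cube root of \<open>zeta = - (t^3) / 9\<close> replaced by its
  constant multiple \<open>t\<close>, so that it is regular at 0.\<close>

definition cubic_sol2 :: "real \<Rightarrow> real \<Rightarrow> real" where
  "cubic_sol2 a t = t * kummerM (a + 1/3) (4/3) (- (t^3) / 9)"

lemma pos_notin_nonpos_Ints: "(b :: real) > 0 \<Longrightarrow> b \<notin> \<int>\<^sub>\<le>\<^sub>0"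
  by (auto elim!: nonpos_Ints_cases)

lemma cubic_ode_sol1:
  "\<exists>w'. cubic_ode a (cubic_sol1 a) w' \<and> w' 0 = 0"
proof -
  define z :: "real \<Rightarrow> real" where "z t = - (t^3) / 9" for t
  define M M1 M2 where "M = kummerM a (2/3)" and "M1 x = a / (2/3) * kummerM (a + 1) (2/3 + 1) x"
    and "M2 x = a / (2/3) * ((a + 1) / (2/3 + 1) * kummerM (a + 2) (2/3 + 2) x)" for x
  have M: "(M has_real_derivative M1 x) (at x)" for x
    unfolding M_def M1_def by (rule has_real_derivative_kummerM) (simp add: pos_notin_nonpos_Ints)
  have M1: "(M1 has_real_derivative M2 x) (at x)" for x
    unfolding M1_def M2_def
    using DERIV_cmult[OF has_real_derivative_kummerM[of "2/3 + 1" "a + 1" x], of "a / (2/3)"]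
    by (simp add: pos_notin_nonpos_Ints add.assoc)
  have ode: "x * M2 x + (2/3 - x) * M1 x - a * M x = 0" for x
    unfolding M_def M1_def M2_def by (rule kummerM_ode) (simp add: pos_notin_nonpos_Ints)
  have z: "(z has_real_derivative - (t\<^sup>2) / 3) (at t)" for t
    unfolding z_def by (auto intro!: derivative_eq_intros)
  define w' where "w' t = - (t\<^sup>2) / 3 * M1 (z t)" for t
  have "(w' has_real_derivative - (2 * t) / 3 * M1 (z t) + (- (t\<^sup>2) / 3)\<^sup>2 * M2 (z t)) (at t)" for t
    unfolding w'_def
    by (auto intro!: derivative_eq_intros DERIV_chain2[OF M1 z]) (simp add: field_simps power2_eq_square)
  moreover have "- (2 * t) / 3 * M1 (z t) + (- (t\<^sup>2) / 3)\<^sup>2 * M2 (z t)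
      = - (t\<^sup>2 / 3) * w' t - a * t * M (z t)" for t
  proof -
    \<comment> \<open>The residual of the cubic equation is \<open>- t\<close> times that of
      Kummer's equation at \<open>z t\<close>.\<close>
    have "- (2 * t) / 3 * M1 (z t) + (- (t\<^sup>2) / 3)\<^sup>2 * M2 (z t) + (t\<^sup>2 / 3) * w' t + a * t * M (z t)
        = - t * (z t * M2 (z t) + (2/3 - z t) * M1 (z t) - a * M (z t))"
      unfolding w'_def z_def by algebra
    then show ?thesis using ode[of "z t"] by simp
  qed
  moreover have "((\<lambda>t. M (z t)) has_real_derivative w' t) (at t)" for t
    unfolding w'_def using DERIV_chain2[OF M z] by (simp add: mult.commute)
  ultimately have "cubic_ode a (\<lambda>t. M (z t)) w'"
    by (simp add: cubic_ode_def)
  moreover have "(\<lambda>t. M (z t)) = cubic_sol1 a"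
    by (simp add: fun_eq_iff M_def z_def cubic_sol1_def)
  moreover have "w' 0 = 0" by (simp add: w'_def)
  ultimately show ?thesis by auto
qed

lemma cubic_ode_sol2:
  "\<exists>w'. cubic_ode a (cubic_sol2 a) w' \<and> w' 0 = 1"
proof -
  define z :: "real \<Rightarrow> real" where "z t = - (t^3) / 9" for t
  define c where "c = a + 1/3"
  define M M1 M2 where "M = kummerM c (4/3)" and "M1 x = c / (4/3) * kummerM (c + 1) (4/3 + 1) x"
    and "M2 x = c / (4/3) * ((c + 1) / (4/3 + 1) * kummerM (c + 2) (4/3 + 2) x)" for x
  have M: "(M has_real_derivative M1 x) (at x)" for x
    unfolding M_def M1_def by (rule has_real_derivative_kummerM) (simp add: pos_notin_nonpos_Ints)
  have M1: "(M1 has_real_derivative M2 x) (at x)" for x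
    unfolding M1_def M2_def
    using DERIV_cmult[OF has_real_derivative_kummerM[of "4/3 + 1" "c + 1" x], of "c / (4/3)"]
    by (simp add: pos_notin_nonpos_Ints add.assoc)
  have ode: "x * M2 x + (4/3 - x) * M1 x - c * M x = 0" for x
    unfolding M_def M1_def M2_def by (rule kummerM_ode) (simp add: pos_notin_nonpos_Ints)
  have z: "(z has_real_derivative - (t\<^sup>2) / 3) (at t)" for t
    unfolding z_def by (auto intro!: derivative_eq_intros)
  \<comment> \<open>Product rule, using \<open>t * z' = 3 * z\<close> for
    \<open>z = - (t^3) / 9\<close>.\<close>
  define w' where "w' t = M (z t) + 3 * z t * M1 (z t)" for t
  have "(w' has_real_derivative (- (t\<^sup>2) / 3) * (4 * M1 (z t) + 3 * z t * M2 (z t))) (at t)" for t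
    unfolding w'_def
    by (auto intro!: derivative_eq_intros z DERIV_chain2[OF M1 z] DERIV_chain2[OF M z])
       (simp add: algebra_simps)
  moreover have "(- (t\<^sup>2) / 3) * (4 * M1 (z t) + 3 * z t * M2 (z t))
      = - (t\<^sup>2 / 3) * w' t - a * t * (t * M (z t))" for t
  proof -
    have "(- (t\<^sup>2) / 3) * (4 * M1 (z t) + 3 * z t * M2 (z t)) + (t\<^sup>2 / 3) * w' t + a * t * (t * M (z t))
        = - (t\<^sup>2) * (z t * M2 (z t) + (4/3 - z t) * M1 (z t) - c * M (z t))"
      by (simp add: w'_def c_def field_simps power2_eq_square)
    then show ?thesis using ode[of "z t"] by simp
  qed
  moreover have "((\<lambda>t. t * M (z t)) has_real_derivative w' t) (at t)" for t
    unfolding w'_def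
    by (auto intro!: derivative_eq_intros DERIV_chain2[OF M z])
       (simp add: z_def power2_eq_square power3_eq_cube)
  ultimately have "cubic_ode a (\<lambda>t. t * M (z t)) w'"
    by (simp add: cubic_ode_def)
  moreover have "(\<lambda>t. t * M (z t)) = cubic_sol2 a"
    by (simp add: fun_eq_iff M_def z_def c_def cubic_sol2_def)
  moreover have "w' 0 = 1" by (simp add: w'_def M_def z_def)
  ultimately show ?thesis by auto
qed

text \<open>Tricomi's \<open>U(a, 2/3, zeta)\<close> in terms of the two Frobenius solutions. The
  real cube root of \<open>zeta\<close> is \<open>- t / 9 powr (1/3)\<close>, whence the minus sign
  and the meaning for both signs of \<open>t\<close>.\<close>

definition cubic_tricomi :: "real \<Rightarrow> real \<Rightarrow> real" where
  "cubic_tricomi a t = Gamma (1/3) * rGamma (a + 1/3) * cubic_sol1 a t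
     - Gamma (-1/3) * rGamma a / 9 powr (1/3) * cubic_sol2 a t"

lemma cubic_ode_tricomi: "\<exists>w'. cubic_ode a (cubic_tricomi a) w'"
  unfolding cubic_tricomi_def using cubic_ode_sol1 cubic_ode_sol2 cubic_ode_lincomb by metis

section \<open>Asymptotics of the two basic solutions\<close>

lemma powr_third_cube_div_9: "s > 0 \<Longrightarrow> (s^3 / 9) powr (1/3) = s / 9 powr (1/3)" for s :: real
  by (simp add: powr_divide powr_powr flip: powr_numeral)

lemma cube_div_9_at_top: "filterlim (\<lambda>s::real. s^3 / 9) at_top at_top"
  by real_asymp

lemma cubic_sol1_at_bot:
  "((\<lambda>s. cubic_sol1 a (- s) * (exp (- (s^3 / 9)) * (s^3 / 9) powr (2/3 - a)))
     \<longlongrightarrow> Gamma (2/3) * rGamma a) at_top"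
proof -
  have "(2/3 :: real) \<notin> \<int>\<^sub>\<le>\<^sub>0" by (simp add: pos_notin_nonpos_Ints)
  from filterlim_compose[OF kummerM_asymp_at_top[OF this, of a] cube_div_9_at_top]
  show ?thesis by (simp add: cubic_sol1_def)
qed

text \<open>Kummer's transformation moves the argument to \<open>+ s^3 / 9\<close>; its factor
  \<open>exp (- (s^3 / 9))\<close> cancels the exponential growth and only a power remains.\<close>

lemma cubic_sol1_at_top:
  "((\<lambda>s. cubic_sol1 a s * (s^3 / 9) powr a) \<longlongrightarrow> Gamma (2/3) * rGamma (2/3 - a)) at_top"
proof -
  have b: "(2/3 :: real) \<notin> \<int>\<^sub>\<le>\<^sub>0" by (simp add: pos_notin_nonpos_Ints)
  from filterlim_compose[OF kummerM_asymp_at_top[OF b, of "2/3 - a"] cube_div_9_at_top]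
  show ?thesis
    using kummer_transformation[OF b, of a] by (simp add: cubic_sol1_def mult_ac)
qed

lemma cubic_sol2_at_bot:
  "((\<lambda>s. cubic_sol2 a (- s) / 9 powr (1/3) * (exp (- (s^3 / 9)) * (s^3 / 9) powr (2/3 - a)))
     \<longlongrightarrow> - Gamma (4/3) * rGamma (a + 1/3)) at_top"
proof -
  have b: "(4/3 :: real) \<notin> \<int>\<^sub>\<le>\<^sub>0" by (simp add: pos_notin_nonpos_Ints)
  have "((\<lambda>s. - (kummerM (a + 1/3) (4/3) (s^3 / 9) * (exp (- (s^3 / 9)) * (s^3 / 9) powr (4/3 - (a + 1/3)))))
      \<longlongrightarrow> - (Gamma (4/3) * rGamma (a + 1/3))) at_top"
    by (intro tendsto_minus filterlim_compose[OF kummerM_asymp_at_top[OF b, of "a + 1/3"] cube_div_9_at_top])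
  moreover have "\<forall>\<^sub>F s in at_top.
      - (kummerM (a + 1/3) (4/3) (s^3 / 9) * (exp (- (s^3 / 9)) * (s^3 / 9) powr (4/3 - (a + 1/3))))
      = cubic_sol2 a (- s) / 9 powr (1/3) * (exp (- (s^3 / 9)) * (s^3 / 9) powr (2/3 - a))"
    using eventually_gt_at_top[of 0]
  proof eventually_elim
    case (elim s)
    \<comment> \<open>The outer factor \<open>t\<close> supplies the missing power 1/3, so both
      solutions are measured on the same scale.\<close>
    have "(s^3 / 9) powr (4/3 - (a + 1/3)) = s / 9 powr (1/3) * (s^3 / 9) powr (2/3 - a)"
      unfolding powr_third_cube_div_9[OF elim, symmetric] powr_add[symmetric] by simp
    then show ?case by (simp add: cubic_sol2_def mult_ac)
  qed
  ultimately show ?thesis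
    by (auto intro: Lim_transform_eventually)
qed

lemma cubic_sol2_at_top:
  "((\<lambda>s. cubic_sol2 a s / 9 powr (1/3) * (s^3 / 9) powr a) \<longlongrightarrow> Gamma (4/3) * rGamma (1 - a)) at_top"
proof -
  have b: "(4/3 :: real) \<notin> \<int>\<^sub>\<le>\<^sub>0" by (simp add: pos_notin_nonpos_Ints)
  have "((\<lambda>s. kummerM (1 - a) (4/3) (s^3 / 9) * (exp (- (s^3 / 9)) * (s^3 / 9) powr (4/3 - (1 - a))))
      \<longlongrightarrow> Gamma (4/3) * rGamma (1 - a)) at_top"
    by (intro filterlim_compose[OF kummerM_asymp_at_top[OF b, of "1 - a"] cube_div_9_at_top])
  moreover have "\<forall>\<^sub>F s in at_top.
      kummerM (1 - a) (4/3) (s^3 / 9) * (exp (- (s^3 / 9)) * (s^3 / 9) powr (4/3 - (1 - a)))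
      = cubic_sol2 a s / 9 powr (1/3) * (s^3 / 9) powr a"
    using eventually_gt_at_top[of 0]
  proof eventually_elim
    case (elim s)
    have "(s^3 / 9) powr (4/3 - (1 - a)) = s / 9 powr (1/3) * (s^3 / 9) powr a"
      unfolding powr_third_cube_div_9[OF elim, symmetric] powr_add[symmetric] by simp
    moreover have "kummerM (a + 1/3) (4/3) (- (s^3) / 9) = exp (- (s^3 / 9)) * kummerM (1 - a) (4/3) (s^3 / 9)"
      using kummer_transformation[OF b, of "a + 1/3" "s^3 / 9"] by simp
    ultimately show ?case by (simp add: cubic_sol2_def mult_ac)
  qed
  ultimately show ?thesis
    by (rule Lim_transform_eventually)
qed

section \<open>Gamma identities and the behaviour of \<open>cubic_tricomi\<close> at both
  ends\<close>

lemma Gamma_2_3: "Gamma (2/3) = - Gamma (-1/3) / (3 :: real)"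
proof -
  have "(-1/3 :: real) \<notin> \<int>"
    using fraction_not_in_Ints[where 'a = real, of 3 "-1"] by simp
  then show ?thesis
    using Gamma_plus1[of "-1/3 :: real"] nonpos_Ints_subset_Ints by fastforce
qed

lemma Gamma_4_3: "Gamma (4/3) = Gamma (1/3) / (3 :: real)"
  using Gamma_plus1[of "1/3 :: real"] by (simp add: pos_notin_nonpos_Ints)

text \<open>Transferred from the complex reflection formula; the reciprocal form has no poles and so
  holds for every real \<open>x\<close>.\<close>

lemma rGamma_reflection_real:
  fixes x :: real
  shows "rGamma x * rGamma (1 - x) = sin (pi * x) / pi"
proof -
  have "complex_of_real (rGamma x * rGamma (1 - x))
      = rGamma (complex_of_real x) * rGamma (1 - complex_of_real x)"
    using rGamma_complex_of_real[of x] rGamma_complex_of_real[of "1 - x"] by simp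
  also have "\<dots> = complex_of_real (sin (pi * x) / pi)"
    using sin_of_real[of "pi * x", where 'a = complex] by (simp add: rGamma_reflection_complex)
  finally have "complex_of_real (rGamma x * rGamma (1 - x)) = complex_of_real (sin (pi * x) / pi)" .
  then show ?thesis by (simp only: of_real_eq_iff)
qed

lemma cubic_tricomi_at_top:
  assumes "a + 1/6 \<in> \<int>"
  shows "((\<lambda>s. cubic_tricomi a s * (s^3 / 9) powr a) \<longlongrightarrow> 0) at_top"
proof -
  let ?L = "Gamma (1/3) * rGamma (a + 1/3) * (Gamma (2/3) * rGamma (2/3 - a))
    - Gamma (-1/3) * rGamma a * (Gamma (4/3) * rGamma (1 - a))"
  have lim: "((\<lambda>s. Gamma (1/3) * rGamma (a + 1/3) * (cubic_sol1 a s * (s^3 / 9) powr a)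
      - Gamma (-1/3) * rGamma a * (cubic_sol2 a s / 9 powr (1/3) * (s^3 / 9) powr a)) \<longlongrightarrow> ?L) at_top"
    by (intro tendsto_intros cubic_sol1_at_top cubic_sol2_at_top)
  \<comment> \<open>Since \<open>Gamma (-1/3) * Gamma (4/3) = - Gamma (1/3) * Gamma (2/3)\<close>, a
    common factor comes out. The reflection formula then gives a sum of sines with factor
    \<open>sin (pi * (a + 1/6))\<close>, which is zero as \<open>a + 1/6\<close> is an
    integer.\<close>
  have "?L = Gamma (1/3) * Gamma (2/3) *
      (rGamma (a + 1/3) * rGamma (1 - (a + 1/3)) + rGamma a * rGamma (1 - a))"
    by (simp add: Gamma_2_3 Gamma_4_3 algebra_simps)
  also have "\<dots> = Gamma (1/3) * Gamma (2/3) / pi * (sin (pi * (a + 1/3)) + sin (pi * a))"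
    by (simp only: rGamma_reflection_real) (simp add: field_simps)
  also have "sin (pi * (a + 1/3)) + sin (pi * a) = 2 * sin (pi * (a + 1/6)) * cos (pi / 6)"
  proof -
    have "sin (pi * (a + 1/3)) = sin (pi * (a + 1/6) + pi / 6)" "sin (pi * a) = sin (pi * (a + 1/6) - pi / 6)"
      by (simp_all add: algebra_simps)
    then show ?thesis by (simp add: sin_add sin_diff)
  qed
  also have "sin (pi * (a + 1/6)) = 0"
    using sin_times_pi_eq_0[of "a + 1/6"] assms by (simp add: mult.commute)
  finally show ?thesis
    using lim by (simp add: cubic_tricomi_def algebra_simps)
qed

lemma cubic_tricomi_at_bot:
  assumes a: "a \<notin> \<int>\<^sub>\<le>\<^sub>0"
  shows "((\<lambda>s. cubic_tricomi a (- s) * (s^3 / 9) powr a) \<longlongrightarrow> 1) at_top"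
proof -
  define C where "C = Gamma (2/3) * rGamma a"
  define B where "B = Gamma (-1/3) * rGamma a / 9 powr (1/3)"
  define z :: "real \<Rightarrow> real" where "z s = s^3 / 9" for s
  define e where "e s = exp (- z s) * z s powr (2/3 - a)" for s
  define Q where "Q s = cubic_tricomi a (- s) / cubic_sol1 a (- s)" for s
  \<comment> \<open>The expected size of \<open>Q\<close> up to \<open>1 / C\<close>: the target
    \<open>z powr (- a)\<close> divided by the growth \<open>exp z * z powr (a - 2/3)\<close> of the
    first solution.\<close>
  define g where "g s = exp (- z s) * z s powr (2/3 - 2 * a)" for s
  define g' where "g' s = s\<^sup>2 / 3 * (exp (- z s) * z s powr (2/3 - 2 * a)) * ((2/3 - 2 * a) / z s - 1)" for s
  have "C \<noteq> 0"
    using a by (auto simp: C_def rGamma_eq_zero_iff Gamma_eq_zero_iff pos_notin_nonpos_Ints)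
  have z_pos: "z s > 0" if "s > 0" for s using that by (simp add: z_def)
  have sol1: "((\<lambda>s. cubic_sol1 a (- s) * e s) \<longlongrightarrow> C) at_top"
    using cubic_sol1_at_bot[of a] by (simp add: e_def z_def C_def)
  have sol2: "((\<lambda>s. cubic_sol2 a (- s) / 9 powr (1/3) * e s) \<longlongrightarrow> - Gamma (4/3) * rGamma (a + 1/3)) at_top"
    using cubic_sol2_at_bot[of a] by (simp add: e_def z_def)
  have sol1_ne: "\<forall>\<^sub>F s in at_top. cubic_sol1 a (- s) \<noteq> 0"
    by (rule eventually_mono[OF tendsto_imp_eventually_ne[OF sol1 \<open>C \<noteq> 0\<close>]]) simp
  \<comment> \<open>Here \<open>u'\<close> is the derivative of the first solution and
    \<open>u\<close> that of the second. Their values at 0 make the Wronskian constant equal to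
    1.\<close>
  obtain u u' where u: "cubic_ode a (cubic_sol1 a) u'" "u' 0 = 0"
    and u2: "cubic_ode a (cubic_sol2 a) u" "u 0 = 1"
    using cubic_ode_sol1[of a] cubic_ode_sol2[of a] by blast
  have tric: "cubic_tricomi a t = Gamma (1/3) * rGamma (a + 1/3) * cubic_sol1 a t - B * cubic_sol2 a t" for t
    by (simp add: cubic_tricomi_def B_def)

  \<comment> \<open>The two exponentially growing contributions cancel by the same Gamma
    relation.\<close>
  have "((\<lambda>s. (Gamma (1/3) * rGamma (a + 1/3)) * (cubic_sol1 a (- s) * e s)
      - (Gamma (-1/3) * rGamma a) * (cubic_sol2 a (- s) / 9 powr (1/3) * e s))
      \<longlongrightarrow> (Gamma (1/3) * rGamma (a + 1/3)) * C
        - (Gamma (-1/3) * rGamma a) * (- Gamma (4/3) * rGamma (a + 1/3))) at_top"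
    by (intro tendsto_diff tendsto_mult[OF tendsto_const] sol1 sol2)
  then have "((\<lambda>s. cubic_tricomi a (- s) * e s) \<longlongrightarrow> 0) at_top"
    by (simp add: C_def Gamma_2_3 Gamma_4_3 cubic_tricomi_def algebra_simps)
  from tendsto_divide[OF this sol1 \<open>C \<noteq> 0\<close>]
  have "((\<lambda>s. cubic_tricomi a (- s) * e s / (cubic_sol1 a (- s) * e s)) \<longlongrightarrow> 0) at_top"
    by simp
  moreover have "\<forall>\<^sub>F s in at_top. cubic_tricomi a (- s) * e s / (cubic_sol1 a (- s) * e s) = Q s"
    by (rule eventually_mono[OF eventually_gt_at_top[of 0]]) (use z_pos in \<open>force simp: Q_def e_def\<close>)
  ultimately have Q_0: "(Q \<longlongrightarrow> 0) at_top"
    by (rule Lim_transform_eventually)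

  have "((\<lambda>s. Q s / g s) \<longlongrightarrow> 1 / C) at_top"
  proof (rule lhopital_0_at_top[OF Q_0])
    show "(g \<longlongrightarrow> 0) at_top"
      unfolding g_def z_def by real_asymp
    show "\<forall>\<^sub>F s in at_top. g s \<noteq> 0"
      by (rule eventually_mono[OF eventually_gt_at_top[of 0]]) (use z_pos in \<open>force simp: g_def\<close>)
    have lim1: "((\<lambda>s. (2/3 - 2 * a) / z s - 1) \<longlongrightarrow> -1) at_top"
      unfolding z_def by real_asymp
    then have "\<forall>\<^sub>F s in at_top. (2/3 - 2 * a) / z s - 1 \<noteq> 0"
      by (rule tendsto_imp_eventually_ne) simp
    then show "\<forall>\<^sub>F s in at_top. g' s \<noteq> 0"
      using eventually_gt_at_top[of 0] by eventually_elim (use z_pos in \<open>force simp: g'_def\<close>)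
    show "\<forall>\<^sub>F s in at_top. (g has_real_derivative g' s) (at s)"
      using eventually_gt_at_top[of 0]
    proof eventually_elim
      case (elim s)
      have z: "(z has_real_derivative s\<^sup>2 / 3) (at s)"
        unfolding z_def by (auto intro!: derivative_eq_intros)
      have p: "z s powr (2/3 - 2 * a - 1) = z s powr (2/3 - 2 * a) / z s"
        using z_pos[OF elim] powr_diff[of "z s" "2/3 - 2 * a" 1] by simp
      have pw: "((\<lambda>s. z s powr (2/3 - 2 * a)) has_real_derivative
          (2/3 - 2 * a) * (z s powr (2/3 - 2 * a) / z s) * (s\<^sup>2 / 3)) (at s)"
        using DERIV_fun_powr[OF z z_pos[OF elim], of "2/3 - 2 * a"] p by simp
      have ex: "((\<lambda>s. exp (- z s)) has_real_derivative exp (- z s) * - (s\<^sup>2 / 3)) (at s)"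
        by (intro DERIV_chain2[OF DERIV_exp] DERIV_minus z)
      show ?case
        unfolding g_def g'_def
        by (rule DERIV_cong[OF DERIV_mult[OF ex pw]]) (simp add: algebra_simps)
    qed
    \<comment> \<open>Only the second solution contributes to the derivative of the quotient, and
      its numerator is \<open>B\<close> times the Wronskian at \<open>- s\<close>.\<close>
    show "\<forall>\<^sub>F s in at_top. (Q has_real_derivative B * exp (z s) / (cubic_sol1 a (- s))\<^sup>2) (at s)"
      using sol1_ne
    proof eventually_elim
      case (elim s)
      have wr: "cubic_sol1 a (- s) * u (- s) - u' (- s) * cubic_sol2 a (- s) = exp (z s)"
        using cubic_ode_wronskian[OF u(1) u2(1), of "- s"] u(2) u2(2)
        by (simp add: z_def cubic_sol1_def cubic_sol2_def)
      have s1: "((\<lambda>s. cubic_sol1 a (- s)) has_real_derivative - u' (- s)) (at s)"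
        using DERIV_chain2[OF cubic_odeD(1)[OF u(1)] DERIV_minus[OF DERIV_ident]] by simp
      have s2: "((\<lambda>s. cubic_sol2 a (- s)) has_real_derivative - u (- s)) (at s)"
        using DERIV_chain2[OF cubic_odeD(1)[OF u2(1)] DERIV_minus[OF DERIV_ident]] by simp
      have "(Q has_real_derivative B * (cubic_sol1 a (- s) * u (- s) - u' (- s) * cubic_sol2 a (- s))
          / (cubic_sol1 a (- s))\<^sup>2) (at s)"
        unfolding Q_def tric
        by (auto intro!: derivative_eq_intros s1 s2 elim) (simp add: algebra_simps power2_eq_square)
      then show ?case by (simp add: wr)
    qed
    \<comment> \<open>The quotient of derivatives is rewritten through
      \<open>cubic_sol1 a (- s) * e s\<close>, whose limit \<open>C\<close> is known. The powers of
      \<open>s\<close> cancel because \<open>z powr (1/3) = s / 9 powr (1/3)\<close>.\<close>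
    have "((\<lambda>s. B * 3 / (9 powr (1/3))\<^sup>2 / (cubic_sol1 a (- s) * e s)\<^sup>2 / ((2/3 - 2 * a) / z s - 1))
        \<longlongrightarrow> B * 3 / (9 powr (1/3))\<^sup>2 / C\<^sup>2 / (-1)) at_top"
      using \<open>C \<noteq> 0\<close> by (intro tendsto_intros sol1 lim1) auto
    moreover have "B * 3 / (9 powr (1/3))\<^sup>2 / C\<^sup>2 / (-1) = 1 / C"
    proof -
      have "(9 powr (1/3) :: real) ^ 3 = 9"
        by (simp add: powr_powr flip: powr_numeral)
      then have "B * 3 / (9 powr (1/3))\<^sup>2 = - C"
        by (simp add: B_def C_def Gamma_2_3 power2_eq_square power3_eq_cube mult.assoc)
      then show ?thesis by (simp add: power2_eq_square)
    qed
    moreover have "\<forall>\<^sub>F s in at_top.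
        B * 3 / (9 powr (1/3))\<^sup>2 / (cubic_sol1 a (- s) * e s)\<^sup>2 / ((2/3 - 2 * a) / z s - 1)
        = B * exp (z s) / (cubic_sol1 a (- s))\<^sup>2 / g' s"
      using eventually_gt_at_top[of 0]
    proof eventually_elim
      case (elim s)
      have "(z s powr (2/3 - a))\<^sup>2 = z s powr (2/3 - 2 * a) * (z s powr (1/3))\<^sup>2"
        by (simp add: power2_eq_square flip: powr_add)
      also have "z s powr (1/3) = s / 9 powr (1/3)"
        unfolding z_def by (rule powr_third_cube_div_9[OF elim])
      finally have "(e s)\<^sup>2 = (exp (- z s))\<^sup>2 * (z s powr (2/3 - 2 * a) * (s / 9 powr (1/3))\<^sup>2)"
        by (simp add: e_def power_mult_distrib)
      then have e2: "(cubic_sol1 a (- s) * e s)\<^sup>2 = (cubic_sol1 a (- s))\<^sup>2 *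
          ((exp (- z s))\<^sup>2 * (z s powr (2/3 - 2 * a) * (s\<^sup>2 / (9 powr (1/3))\<^sup>2)))"
        by (simp add: power_mult_distrib power_divide)
      \<comment> \<open>With the exponential and the powers abstracted, a rational identity remains;
        if \<open>r\<close> or \<open>D\<close> is 0, both sides are 0 by the convention for
        division.\<close>
      have alg: "B * 3 / N\<^sup>2 / (r\<^sup>2 * (E\<^sup>2 * (p * (s\<^sup>2 / N\<^sup>2)))) / D = B * inverse E / r\<^sup>2 / (s\<^sup>2 / 3 * (E * p) * D)"
        if "N \<noteq> 0" "E \<noteq> 0" "p \<noteq> 0" for N E p r D :: real
        using that elim by (cases "r = 0"; cases "D = 0") (simp_all add: field_simps power2_eq_square)
      have exp_z: "exp (z s) = inverse (exp (- z s))"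
        by (simp add: exp_minus)
      show ?case
        unfolding e2 g'_def exp_z by (rule alg) (use z_pos[OF elim] in simp_all)
    qed
    ultimately show "((\<lambda>s. B * exp (z s) / (cubic_sol1 a (- s))\<^sup>2 / g' s) \<longlongrightarrow> 1 / C) at_top"
      using Lim_transform_eventually by fastforce
  qed
  from tendsto_mult[OF this sol1]
  have "((\<lambda>s. Q s / g s * (cubic_sol1 a (- s) * e s)) \<longlongrightarrow> 1) at_top"
    using \<open>C \<noteq> 0\<close> by simp
  moreover have "\<forall>\<^sub>F s in at_top. Q s / g s * (cubic_sol1 a (- s) * e s)
      = cubic_tricomi a (- s) * (s^3 / 9) powr a"
    using sol1_ne eventually_gt_at_top[of 0]
  proof eventually_elim
    case (elim s)
    have "z s powr (2/3 - a) = z s powr (2/3 - 2 * a) * z s powr a"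
      by (simp flip: powr_add)
    then show ?case
      using elim z_pos[of s] by (simp add: Q_def g_def e_def z_def)
  qed
  ultimately show ?thesis
    by (rule Lim_transform_eventually)
qed

section \<open>The functions \<open>\<Lambda>\<^sub>k\<close> and \<open>v\<^sub>k\<close>\<close>

lemma smooth_real_coinduct:
  assumes "f \<in> S" and S: "\<And>g x. g \<in> S \<Longrightarrow> g differentiable (at x)" "\<And>g. g \<in> S \<Longrightarrow> deriv g \<in> S"
  shows "smooth_real f"
proof -
  have "(deriv ^^ n) f \<in> S" for n
    by (induction n) (use assms in auto)
  then show ?thesis by (simp add: smooth_real_def S(1))
qed

lemma smooth_real_weighted_cubic_ode:
  assumes w: "cubic_ode a w w'"
  shows "smooth_real (\<lambda>t. (1 + t\<^sup>2) powr q * w t)"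
proof (rule smooth_real_coinduct)
  let ?f = "\<lambda>q P R t. (1 + t\<^sup>2) powr q * (poly P t * w t + poly R t * w' t)"
  \<comment> \<open>This family is closed under differentiation, since the differential equation
    expresses the derivative of \<open>w'\<close> in \<open>w\<close> and \<open>w'\<close> with
    polynomial coefficients.\<close>
  define S where "S = {?f q P R | q P R. True}"
  have "(\<lambda>t. (1 + t\<^sup>2) powr q * w t) = ?f q 1 0" by simp
  then show "(\<lambda>t. (1 + t\<^sup>2) powr q * w t) \<in> S" unfolding S_def by blast
  \<comment> \<open>Differentiating the weight lowers \<open>q\<close> by one; the other terms
    absorb a factor \<open>1 + t^2\<close>, the polynomial \<open>[:1, 0, 1:]\<close>, to
    match.\<close>
  define P' where "P' q P R = [:0, 2 * q:] * P + [:1, 0, 1:] * (pderiv P - [:0, a:] * R)" for q :: real and P R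
  define R' where "R' q P R = [:0, 2 * q:] * R + [:1, 0, 1:] * (P + pderiv R - [:0, 0, 1/3:] * R)" for q :: real and P R
  have D: "(?f q P R has_real_derivative ?f (q - 1) (P' q P R) (R' q P R) t) (at t)" for q P R t
  proof -
    have pos: "1 + t\<^sup>2 > 0" using zero_le_power2[of t] by linarith
    have "((\<lambda>t. 1 + t\<^sup>2) has_real_derivative 2 * t) (at t)"
      by (auto intro!: derivative_eq_intros)
    from DERIV_fun_powr[OF this pos, of q]
    have pw: "((\<lambda>t. (1 + t\<^sup>2) powr q) has_real_derivative q * (1 + t\<^sup>2) powr (q - 1) * (2 * t)) (at t)"
      by simp
    have lin: "((\<lambda>t. poly P t * w t + poly R t * w' t) has_real_derivative
        poly (pderiv P) t * w t + poly P t * w' t + (poly (pderiv R) t * w' t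
          + poly R t * (- (t\<^sup>2 / 3) * w' t - a * t * w t))) (at t)"
      by (auto intro!: derivative_eq_intros cubic_odeD[OF w] poly_DERIV)
    have e: "(1 + t\<^sup>2) powr q = (1 + t\<^sup>2) powr (q - 1) * (1 + t\<^sup>2)"
      using pos powr_add[of "1 + t\<^sup>2" "q - 1" 1] by simp
    have "q * h * (2 * t) * (poly P t * w t + poly R t * w' t)
        + (poly (pderiv P) t * w t + poly P t * w' t + (poly (pderiv R) t * w' t
          + poly R t * (- (t\<^sup>2 / 3) * w' t - a * t * w t))) * (h * (1 + t\<^sup>2))
        = h * (poly (P' q P R) t * w t + poly (R' q P R) t * w' t)" for h
      by (simp add: P'_def R'_def field_simps power2_eq_square)
    then show ?thesis
      by (intro DERIV_cong[OF DERIV_mult[OF pw lin]]) (simp only: e)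
  qed
  show "g differentiable (at x)" if "g \<in> S" for g x
  proof -
    obtain q P R where "g = ?f q P R" using \<open>g \<in> S\<close> unfolding S_def by blast
    then show ?thesis using D real_differentiable_def by blast
  qed
  show "deriv g \<in> S" if "g \<in> S" for g
  proof -
    obtain q P R where "g = ?f q P R" using \<open>g \<in> S\<close> unfolding S_def by blast
    moreover have "deriv (?f q P R) = ?f (q - 1) (P' q P R) (R' q P R)"
      by (intro ext DERIV_imp_deriv D)
    ultimately show ?thesis unfolding S_def by blast
  qed
qed

lemma bounded_range_if_tendsto:
  fixes f :: "real \<Rightarrow> real"
  assumes cont: "continuous_on UNIV f"
    and bot: "(f \<longlongrightarrow> l) at_bot" and top: "(f \<longlongrightarrow> u) at_top"
  shows "bounded (range f)"
proof -
  obtain A where A: "\<And>t. t \<le> A \<Longrightarrow> dist (f t) l < 1"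
    using tendstoD[OF bot zero_less_one] by (auto simp: eventually_at_bot_linorder)
  obtain B where B: "\<And>t. t \<ge> B \<Longrightarrow> dist (f t) u < 1"
    using tendstoD[OF top zero_less_one] by (auto simp: eventually_at_top_linorder)
  have "bounded (f ` {A..B})"
    by (intro compact_imp_bounded compact_continuous_image continuous_on_subset[OF cont]) auto
  then have "bounded (ball l 1 \<union> ball u 1 \<union> f ` {A..B})"
    by auto
  moreover have "range f \<subseteq> ball l 1 \<union> ball u 1 \<union> f ` {A..B}"
  proof
    fix y assume "y \<in> range f"
    then obtain t where "y = f t" by blast
    then show "y \<in> ball l 1 \<union> ball u 1 \<union> f ` {A..B}"
      using A[of t] B[of t] by (cases "t \<le> A"; cases "t \<ge> B") (auto simp: dist_commute)
  qed
  ultimately show ?thesis by (rule bounded_subset)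
qed

section \<open>Expressing the given functions through \<open>cubic_tricomi\<close>, and their
  properties\<close>

lemma Lambda_eq_cubic_tricomi:
  fixes k :: int
  defines "a \<equiv> -1/6 - of_int k"
  shows "Lambda k t = 9 powr (- a) * ((1 + t\<^sup>2) powr (3 * a / 2) * cubic_tricomi a t)"
proof -
  have "-1/4 - 3 * real_of_int k / 2 = 3 * a / 2" "1/6 + real_of_int k = - a"
    "1/6 - real_of_int k = a + 1/3"
    by (simp_all add: a_def field_simps)
  then show ?thesis
    unfolding Lambda_def cubic_tricomi_def cubic_sol1_def cubic_sol2_def a_def[symmetric]
    by (simp only: rGamma_inverse_Gamma) (simp add: field_simps)
qed

text \<open>Since \<open>r^2 = x powr (2/3) * (1 + t^2)\<close>, the power of \<open>r\<close>
  cancels the weight \<open>(1 + t^2) powr (3 * a / 2)\<close> inside \<open>Lambda\<close>, leaving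
  a self-similar form.\<close>

lemma vfun_eq_cubic_tricomi:
  fixes k :: int
  defines "a \<equiv> -1/6 - of_int k"
  assumes x: "x > 0"
  shows "vfun k x z = 9 powr (- a) * x powr (- a) * cubic_tricomi a (z * x powr (-1/3))"
proof -
  define t where "t = z * x powr (-1/3)"
  have pos: "1 + t\<^sup>2 > 0" using zero_le_power2[of t] by linarith
  have "(x powr (-1/3))\<^sup>2 * x powr (2/3) = 1"
    using x by (simp add: power2_eq_square flip: powr_add)
  then have "z\<^sup>2 + x powr (2/3) = x powr (2/3) * (1 + t\<^sup>2)"
    by (simp add: t_def power_mult_distrib distrib_left mult_ac)
  then have "sqrt (z\<^sup>2 + x powr (2/3)) = (x powr (2/3) * (1 + t\<^sup>2)) powr (1/2)"
    using pos by (simp add: powr_half_sqrt)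
  also have "\<dots> powr (- 3 * a) = x powr (- a) * (1 + t\<^sup>2) powr (- (3 * a / 2))"
    using pos x by (simp add: powr_powr powr_mult)
  finally have r: "sqrt (z\<^sup>2 + x powr (2/3)) powr (- 3 * a) = x powr (- a) * (1 + t\<^sup>2) powr (- (3 * a / 2))" .
  have e: "1/2 + 3 * real_of_int k = - 3 * a"
    by (simp add: a_def)
  have "(1 + t\<^sup>2) powr (- (3 * a / 2)) * (1 + t\<^sup>2) powr (3 * a / 2) = 1"
    using pos by (simp flip: powr_add)
  then show ?thesis
    unfolding vfun_def e r t_def[symmetric] Lambda_eq_cubic_tricomi a_def[symmetric]
    by (simp add: mult_ac)
qed

text \<open>Isolates a factor tending to 1 at both ends, so that the limits of \<open>Lambda\<close>
  are those of the normalised \<open>cubic_tricomi\<close>.\<close>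

lemma Lambda_eq_rescaled_cubic_tricomi:
  fixes k :: int
  defines "a \<equiv> -1/6 - of_int k"
  assumes "t \<noteq> 0"
  shows "Lambda k t = ((1 + t\<^sup>2) / t\<^sup>2) powr (3 * a / 2) * (cubic_tricomi a t * (\<bar>t\<bar>^3 / 9) powr a)"
proof -
  have "(\<bar>t\<bar>\<^sup>2) powr (3 * a / 2) = \<bar>t\<bar> powr (3 * a)" "(\<bar>t\<bar>^3) powr a = \<bar>t\<bar> powr (3 * a)"
    by (simp_all only: powr_powr abs_ge_zero flip: powr_numeral) simp_all
  moreover have "((1 + t\<^sup>2) / t\<^sup>2) powr (3 * a / 2) = (1 + t\<^sup>2) powr (3 * a / 2) / (t\<^sup>2) powr (3 * a / 2)"
    by (rule powr_divide)
  moreover have "(\<bar>t\<bar>^3 / 9) powr a = (\<bar>t\<bar>^3) powr a * 9 powr (- a)"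
    by (simp add: powr_divide powr_minus_divide)
  ultimately show ?thesis
    using assms(2) Lambda_eq_cubic_tricomi[of k t, folded a_def] by simp
qed

lemma Lambda_at_bot: "(Lambda k \<longlongrightarrow> 1) at_bot"
proof -
  define a where "a = -1/6 - real_of_int k"
  have "a \<notin> \<int>"
  proof
    assume "a \<in> \<int>"
    then have "-1 / 6 \<in> (\<int> :: real set)"
      using Ints_add[of a "of_int k"] by (simp add: a_def)
    then show False
      using fraction_not_in_Ints[where 'a = real, of 6 "-1"] by simp
  qed
  then have "a \<notin> \<int>\<^sub>\<le>\<^sub>0" using nonpos_Ints_subset_Ints by blast
  from cubic_tricomi_at_bot[OF this]
  have "((\<lambda>s. ((1 + s\<^sup>2) / s\<^sup>2) powr (3 * a / 2) * (cubic_tricomi a (- s) * (s^3 / 9) powr a)) \<longlongrightarrow> 1 * 1) at_top"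
  proof (intro tendsto_mult)
    show "((\<lambda>s::real. ((1 + s\<^sup>2) / s\<^sup>2) powr (3 * a / 2)) \<longlongrightarrow> 1) at_top"
      by real_asymp
  qed
  moreover have "\<forall>\<^sub>F s in at_top. ((1 + s\<^sup>2) / s\<^sup>2) powr (3 * a / 2) * (cubic_tricomi a (- s) * (s^3 / 9) powr a)
      = Lambda k (- s)"
    using eventually_gt_at_top[of 0]
  proof eventually_elim
    case (elim s)
    then show ?case using Lambda_eq_rescaled_cubic_tricomi[of "- s" k, folded a_def] by simp
  qed
  ultimately have "((\<lambda>s. Lambda k (- s)) \<longlongrightarrow> 1 * 1) at_top"
    by (rule Lim_transform_eventually)
  then show ?thesis
    by (simp add: filterlim_at_bot_mirror)
qed

lemma Lambda_at_top: "(Lambda k \<longlongrightarrow> 0) at_top"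
proof -
  define a where "a = -1/6 - real_of_int k"
  have "a + 1/6 \<in> \<int>" by (simp add: a_def)
  from cubic_tricomi_at_top[OF this]
  have "((\<lambda>s. ((1 + s\<^sup>2) / s\<^sup>2) powr (3 * a / 2) * (cubic_tricomi a s * (s^3 / 9) powr a)) \<longlongrightarrow> 1 * 0) at_top"
  proof (intro tendsto_mult)
    show "((\<lambda>s::real. ((1 + s\<^sup>2) / s\<^sup>2) powr (3 * a / 2)) \<longlongrightarrow> 1) at_top"
      by real_asymp
  qed
  moreover have "\<forall>\<^sub>F s in at_top. ((1 + s\<^sup>2) / s\<^sup>2) powr (3 * a / 2) * (cubic_tricomi a s * (s^3 / 9) powr a)
      = Lambda k s"
    using eventually_gt_at_top[of 0]
  proof eventually_elim
    case (elim s)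
    then show ?case using Lambda_eq_rescaled_cubic_tricomi[of s k, folded a_def] by simp
  qed
  ultimately have "(Lambda k \<longlongrightarrow> 1 * 0) at_top"
    by (rule Lim_transform_eventually)
  then show ?thesis by simp
qed

lemma smooth_Lambda: "smooth_real (Lambda k)"
proof -
  define a where "a = -1/6 - real_of_int k"
  obtain w' where w: "cubic_ode a (cubic_tricomi a) w'" using cubic_ode_tricomi by blast
  have "cubic_ode a (\<lambda>t. 9 powr (- a) * cubic_tricomi a t) (\<lambda>t. 9 powr (- a) * w' t)"
    using cubic_ode_lincomb[OF w w, of "9 powr (- a)" 0] by simp
  moreover have "Lambda k = (\<lambda>t. (1 + t\<^sup>2) powr (3 * a / 2) * (9 powr (- a) * cubic_tricomi a t))"
    by (simp add: fun_eq_iff Lambda_eq_cubic_tricomi a_def)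
  ultimately show ?thesis
    using smooth_real_weighted_cubic_ode by simp
qed

text \<open>For fixed \<open>z > 0\<close>, letting \<open>x\<close> decrease to 0 sends
  \<open>t\<close> to infinity, where \<open>Lambda\<close> vanishes, while \<open>r\<close> tends
  to \<open>z\<close>.\<close>

lemma vfun_tendsto_0:
  assumes "z > 0"
  shows "((\<lambda>x. vfun k x z) \<longlongrightarrow> 0) (at_right 0)"
proof -
  have "((\<lambda>x. sqrt (z\<^sup>2 + x powr (2/3)) powr (1/2 + 3 * of_int k)) \<longlongrightarrow> z powr (1/2 + 3 * of_int k)) (at_right 0)"
  proof (intro tendsto_powr tendsto_const)
    have "((\<lambda>x::real. x powr (2/3)) \<longlongrightarrow> 0) (at_right 0)"
      by real_asymp
    then have "((\<lambda>x. sqrt (z\<^sup>2 + x powr (2/3))) \<longlongrightarrow> sqrt (z\<^sup>2 + 0)) (at_right 0)"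
      by (intro tendsto_intros)
    then show "((\<lambda>x. sqrt (z\<^sup>2 + x powr (2/3))) \<longlongrightarrow> z) (at_right 0)"
      using assms by simp
  qed (use assms in simp)
  moreover have "filterlim (\<lambda>x. z * x powr (-1/3)) at_top (at_right 0)"
    using assms by real_asymp
  then have "((\<lambda>x. Lambda k (z * x powr (-1/3))) \<longlongrightarrow> 0) (at_right 0)"
    by (rule filterlim_compose[OF Lambda_at_top])
  ultimately have "((\<lambda>x. vfun k x z) \<longlongrightarrow> z powr (1/2 + 3 * of_int k) * 0) (at_right 0)"
    unfolding vfun_def by (rule tendsto_mult)
  then show ?thesis by simp
qed

lemma vfun_pde:
  assumes x: "x > 0"
  shows "(\<lambda>x'. vfun k x' z) differentiable (at x)"
    and "(\<lambda>z''. vfun k x z'') differentiable (at z')"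
    and "deriv (\<lambda>z'. vfun k x z') differentiable (at z)"
    and "z * deriv (\<lambda>x'. vfun k x' z) x - deriv (deriv (\<lambda>z'. vfun k x z')) z = 0"
proof -
  define a where "a = -1/6 - real_of_int k"
  define c :: real where "c = 9 powr (- a)"
  define y where "y = x powr (-1/3)"
  obtain w' where w: "cubic_ode a (cubic_tricomi a) w'" using cubic_ode_tricomi by blast
  let ?w = "cubic_tricomi a"
  have v: "vfun k x z = c * x powr (- a) * ?w (z * x powr (-1/3))" if "x > 0" for x z
    using vfun_eq_cubic_tricomi[OF that, of k z] by (simp add: a_def c_def)
  have y: "((\<lambda>x. x powr (-1/3)) has_real_derivative (-1/3) * (x powr (-1) * y)) (at x)"
    using has_real_derivative_powr[OF x, of "-1/3"] x powr_add[of x "-1" "-1/3"]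
    by (simp add: y_def mult.commute)
  have xa: "((\<lambda>x. x powr (- a)) has_real_derivative - a * (x powr (-1) * x powr (- a))) (at x)"
    using has_real_derivative_powr[OF x, of "- a"] x powr_add[of x "- a" "-1"] by simp
  have "((\<lambda>x. c * x powr (- a) * ?w (z * x powr (-1/3))) has_real_derivative
      c * (- a * (x powr (-1) * x powr (- a))) * ?w (z * y)
      + c * x powr (- a) * (w' (z * y) * (z * ((-1/3) * (x powr (-1) * y))))) (at x)"
    by (rule DERIV_cong[OF DERIV_mult[OF DERIV_cmult[OF xa]
            DERIV_chain2[OF cubic_odeD(1)[OF w] DERIV_cmult[OF y]]]])
       (simp add: y_def)
  then have Dx: "((\<lambda>x. vfun k x z) has_real_derivative
      c * (- a * (x powr (-1) * x powr (- a))) * ?w (z * y)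
      + c * x powr (- a) * (w' (z * y) * (z * ((-1/3) * (x powr (-1) * y))))) (at x)"
    \<comment> \<open>The self-similar form is available only for positive \<open>x\<close>, so the
      derivative is transferred within the open half-line.\<close>
    by (rule has_field_derivative_transform_within_open[of _ _ _ "{0<..}"]) (use x v in auto)
  have vz: "(\<lambda>z. vfun k x z) = (\<lambda>z. c * x powr (- a) * ?w (z * y))"
    using v[OF x] by (simp add: y_def)
  have Dz: "((\<lambda>z. vfun k x z) has_real_derivative c * x powr (- a) * (w' (z * y) * y)) (at z)" for z
    unfolding vz by (auto intro!: derivative_eq_intros DERIV_chain2[OF cubic_odeD(1)[OF w]])
  then have dz: "deriv (\<lambda>z. vfun k x z) = (\<lambda>z. c * x powr (- a) * (w' (z * y) * y))"
    using DERIV_imp_deriv by blast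
  have Dzz: "(deriv (\<lambda>z. vfun k x z) has_real_derivative c * x powr (- a) *
      (((- ((z * y)\<^sup>2 / 3) * w' (z * y) - a * (z * y) * ?w (z * y)) * y) * y)) (at z)"
    unfolding dz by (auto intro!: derivative_eq_intros DERIV_chain2[OF cubic_odeD(2)[OF w]])
  show "(\<lambda>x'. vfun k x' z) differentiable (at x)"
    "(\<lambda>z''. vfun k x z'') differentiable (at z')"
    "deriv (\<lambda>z'. vfun k x z') differentiable (at z)"
    using Dx Dz Dzz by (auto simp: real_differentiable_def)
  \<comment> \<open>This relation gives both terms of the equation the common factor
    \<open>c * x powr (- a) * y ^ 3\<close>; the rest cancels identically.\<close>
  have "x powr (-1) = y ^ 3"
    using x by (simp add: y_def powr_powr flip: powr_numeral)
  then show "z * deriv (\<lambda>x'. vfun k x' z) x - deriv (deriv (\<lambda>z'. vfun k x z')) z = 0"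
    unfolding DERIV_imp_deriv[OF Dx] DERIV_imp_deriv[OF Dzz]
    by (simp add: power2_eq_square power3_eq_cube algebra_simps)
qed

theorem proposition2p13:
  fixes k :: int
  shows "smooth_real (Lambda k)
    \<and> bounded (range (Lambda k))
    \<and> (Lambda k \<longlongrightarrow> 1) at_bot
    \<and> (Lambda k \<longlongrightarrow> 0) at_top
    \<and> (\<forall>x z. x > 0 \<longrightarrow>
          (\<lambda>x'. vfun k x' z) differentiable (at x)
        \<and> (\<forall>z'. (\<lambda>z''. vfun k x z'') differentiable (at z'))
        \<and> deriv (\<lambda>z'. vfun k x z') differentiable (at z)
        \<and> z * deriv (\<lambda>x'. vfun k x' z) x - deriv (deriv (\<lambda>z'. vfun k x z')) z = 0)
    \<and> (\<forall>z. z > 0 \<longrightarrow> ((\<lambda>x. vfun k x z) \<longlongrightarrow> 0) (at_right 0))"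
proof -
  have "Lambda k differentiable (at t)" for t
    using smooth_Lambda[of k, unfolded smooth_real_def, rule_format, of 0] by simp
  then have "continuous_on UNIV (Lambda k)"
    by (intro continuous_at_imp_continuous_on ballI differentiable_imp_continuous_within)
  then have "bounded (range (Lambda k))"
    by (rule bounded_range_if_tendsto[OF _ Lambda_at_bot Lambda_at_top])
  then show ?thesis
    by (intro conjI allI impI smooth_Lambda Lambda_at_bot Lambda_at_top vfun_pde vfun_tendsto_0)
qed

end
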